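(* Let $n\ge1$. For any $S\in Sp(2n,\mathbb{R})$, the map $$\Theta_{CH_n}\to PH_n,\qquad ({\bf d},{\bf v})\mapsto\left(S^T\begin{bmatrix}D&0\\0&D\end{bmatrix}S,\ S^{-1}{\bf v}\right),\quad D=\mathrm{diag}({\bf d}),$$ induces on the quotient spaces a map $\Phi:\Theta_{CH_n}/\!\sim_\star\ \to\ PH_n/\!\sim_{sys}$ that does not depend on $S\in Sp(2n,\mathbb{R})$ and is given by $$\Phi([{\bf d},{\bf v}]_\star)=\left[\begin{bmatrix}D&0\\0&D\end{bmatrix},{\bf v}\right]_{sys},\qquad D=\mathrm{diag}({\bf d}).$$ Moreover, $\Phi$ is a homeomorphism with respect to the quotient topologies.
   Context: $\mathbb{M}_k$ denotes real $k\times k$ matrices, $\mathbb{J}=\begin{bmatrix}0&\mathbb{I}_n\\-\mathbb{I}_n&0\end{bmatrix}\in\mathbb{M}_{2n}$, and $Sp(2n,\mathbb{R})=\{S\in\mathbb{M}_{2n}:S^T\mathbb{J}S=\mathbb{J}\}$. $PH_n$ is identified with the set of pairs $(Q,B)$ with $Q\in\mathbb{M}_{2n}$ symmetric positive-definite and $B\in\mathbb{R}^{2n}$ (each pair stands for the linear port-Hamiltonian system $\dot{\bf z}=\mathbb{J}Q{\bf z}+Bu$, $y=B^TQ{\bf z}$), with its natural topology as an open subset of (symmetric $2n\times 2n$ matrices)$\,\times\mathbb{R}^{2n}$. Two elements are $\sim_{sys}$-equivalent (linearly system isomorphic), $(Q_1,B_1)\sim_{sys}(Q_2,B_2)$, if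 there is an invertible $L\in\mathbb{M}_{2n}$ with $L\mathbb{J}Q_1=\mathbb{J}Q_2L$, $LB_1=B_2$ and $B_1^TQ_1=B_2^TQ_2L$. Classes are written $[Q,B]_{sys}$. $\Theta_{CH_n}=\{({\bf d},{\bf v}):{\bf d}\in\mathbb{R}^n,\ d_i>0\ \forall i,\ {\bf v}\in\mathbb{R}^{2n}\}$ with its topology as a subset of $\mathbb{R}^{3n}$. On it, $({\bf d}_1,{\bf v}_1)\sim_\star({\bf d}_2,{\bf v}_2)$ means: with $D_i=\mathrm{diag}({\bf d}_i)$, there exist a permutation matrix $P_\sigma\in\mathbb{M}_n$ and an invertible matrix $A\in\mathbb{M}_{2n}$ such that, writing $P=\begin{bmatrix}P_\sigma&0\\0&P_\sigma\end{bmatrix}$, (i) $P\begin{bmatrix}D_1&0\\0&D_1\end{bmatrix}P^T=\begin{bmatrix}D_2&0\\0&D_2\end{bmatrix}$; (ii) $A^T\begin{bmatrix}D_1&0\\0&D_1\end{bmatrix}A{\bf v}_1=\begin{bmatrix}D_1&0\\0&D_1\end{bmatrix}{\bf v}_1$; (iii) $A\mathbb{J}\begin{bmatrix}D_1&0\\0&D_1\end{bmatrix}=\mathbb{J}\begin{bmatrix}D_1&0\\0&D_1\end{bmatrix}A$; (iv) ${\bf v}_2=PA{\bf v}_1$. This is an equivalence relation on $\Theta_{CH_n}$; classes are written $[{\bf d},{\bf v}]_\star$. *)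

theory Defs
  imports "HOL-Analysis.Analysis"
begin

subsection \<open>Quotient spaces\<close>

text \<open>The points of the quotient space are the equivalence classes, i.e. the elements of
  \<open>topspace X // r\<close>.\<close>

definition quotient_topology :: "'a topology \<Rightarrow> ('a \<times> 'a) set \<Rightarrow> 'a set topology" where
  "quotient_topology X r =
     topology (\<lambda>U. U \<subseteq> topspace X // r \<and> openin X {x \<in> topspace X. r `` {x} \<in> U})"

lemma openin_quotient_topology:
  "openin (quotient_topology X r) U \<longleftrightarrow>
     U \<subseteq> topspace X // r \<and> openin X {x \<in> topspace X. r `` {x} \<in> U}"
proof -
  have "istopology (\<lambda>U. U \<subseteq> topspace X // r \<and> openin X {x \<in> topspace X. r `` {x} \<in> U})"
    unfolding istopology_def
  proof (intro conjI allI impI)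
    fix S T
    assume S: "S \<subseteq> topspace X // r \<and> openin X {x \<in> topspace X. r `` {x} \<in> S}"
      and T: "T \<subseteq> topspace X // r \<and> openin X {x \<in> topspace X. r `` {x} \<in> T}"
    show "S \<inter> T \<subseteq> topspace X // r" using S by blast
    have "{x \<in> topspace X. r `` {x} \<in> S \<inter> T} =
        {x \<in> topspace X. r `` {x} \<in> S} \<inter> {x \<in> topspace X. r `` {x} \<in> T}" by blast
    then show "openin X {x \<in> topspace X. r `` {x} \<in> S \<inter> T}" using S T by auto
  next
    fix K
    assume K: "\<forall>U\<in>K. U \<subseteq> topspace X // r \<and> openin X {x \<in> topspace X. r `` {x} \<in> U}"
    show "\<Union> K \<subseteq> topspace X // r" using K by blast
    have "{x \<in> topspace X. r `` {x} \<in> \<Union> K} =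
        (\<Union>U\<in>K. {x \<in> topspace X. r `` {x} \<in> U})" by blast
    then show "openin X {x \<in> topspace X. r `` {x} \<in> \<Union> K}" using K by auto
  qed
  then show ?thesis by (simp add: quotient_topology_def)
qed

lemma topspace_quotient_topology: "topspace (quotient_topology X r) = topspace X // r"
proof -
  have "{x \<in> topspace X. r `` {x} \<in> topspace X // r} = topspace X"
    by (auto simp: quotient_def)
  then have "openin (quotient_topology X r) (topspace X // r)"
    by (simp add: openin_quotient_topology)
  then show ?thesis
    by (meson openin_subset openin_quotient_topology openin_topspace subset_antisym)
qed

lemma quotient_map_proj: "quotient_map X (quotient_topology X r) (\<lambda>x. r `` {x})"
  by (auto simp: quotient_map_def openin_quotient_topology topspace_quotient_topology quotient_def)

definition induces_on_quotients ::
  "('a \<Rightarrow> 'b) \<Rightarrow> 'a set \<Rightarrow> ('a \<times> 'a) set \<Rightarrow> 'b set \<Rightarrow> ('b \<times> 'b) set \<Rightarrow> ('a set \<Rightarrow> 'b set) \<Rightarrow> bool"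
  where
  "induces_on_quotients f X r Y s F \<longleftrightarrow>
     f ` X \<subseteq> Y \<and>
     (\<forall>x y. (x, y) \<in> r \<longrightarrow> (f x, f y) \<in> s) \<and>
     (\<forall>x\<in>X. F (r `` {x}) = s `` {f x})"

subsection \<open>Matrices\<close>

text \<open>Here \<open>n = CARD('n)\<close>; vectors of length \<open>2n\<close> are indexed by \<open>'n + 'n\<close>, with
  \<open>Inl\<close> for the first \<open>n\<close> and \<open>Inr\<close> for the last \<open>n\<close> coordinates.\<close>

type_synonym 'n vec2 = "(real, 'n + 'n) vec"
type_synonym 'n mat2 = "(('n vec2), 'n + 'n) vec"

definition block_matrix ::
  "real^'n::finite^'n \<Rightarrow> real^'n^'n \<Rightarrow> real^'n^'n \<Rightarrow> real^'n^'n \<Rightarrow> 'n mat2" where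
  "block_matrix A B C D =
     (\<chi> i j. case i of
        Inl a \<Rightarrow> (case j of Inl b \<Rightarrow> A $ a $ b | Inr b \<Rightarrow> B $ a $ b)
      | Inr a \<Rightarrow> (case j of Inl b \<Rightarrow> C $ a $ b | Inr b \<Rightarrow> D $ a $ b))"

definition diag :: "real^'n::finite \<Rightarrow> real^'n^'n" where
  "diag d = (\<chi> i j. if i = j then d $ i else 0)"

definition diag2 :: "real^'n::finite \<Rightarrow> 'n mat2" where
  "diag2 d = block_matrix (diag d) 0 0 (diag d)"

definition perm_matrix :: "('n::finite \<Rightarrow> 'n) \<Rightarrow> real^'n^'n" where
  "perm_matrix \<sigma> = (\<chi> i j. if i = \<sigma> j then 1 else 0)"

definition perm2 :: "('n::finite \<Rightarrow> 'n) \<Rightarrow> 'n mat2" where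
  "perm2 \<sigma> = block_matrix (perm_matrix \<sigma>) 0 0 (perm_matrix \<sigma>)"

definition JJ :: "('n::finite) mat2" where
  "JJ = block_matrix 0 (mat 1) (- mat 1) 0"

definition Sp :: "(('n::finite) mat2) set" where
  "Sp = {S. transpose S ** JJ ** S = JJ}"

definition sym_pos_def :: "real^'m^'m \<Rightarrow> bool" where
  "sym_pos_def Q \<longleftrightarrow> transpose Q = Q \<and> (\<forall>x. x \<noteq> 0 \<longrightarrow> x \<bullet> (Q *v x) > 0)"

subsection \<open>Port-Hamiltonian systems and their parameters\<close>

definition PH :: "(('n::finite) mat2 \<times> 'n vec2) set" where
  "PH = {(Q, B). sym_pos_def Q}"

text \<open>A row vector times a matrix, such as \<open>B\<^sup>T Q\<close>, is written \<open>B v* Q\<close>.\<close>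

definition sys_rel :: "((('n::finite) mat2 \<times> 'n vec2) \<times> ('n mat2 \<times> 'n vec2)) set" where
  "sys_rel = {((Q1, B1), (Q2, B2)). (Q1, B1) \<in> PH \<and> (Q2, B2) \<in> PH \<and>
     (\<exists>L. invertible L \<and>
        L ** JJ ** Q1 = JJ ** Q2 ** L \<and>
        L *v B1 = B2 \<and>
        B1 v* Q1 = B2 v* (Q2 ** L))}"

text \<open>The product \<open>(real^'n) \<times> (real^('n + 'n))\<close> plays the role of \<open>\<real>\<^sup>3\<^sup>n\<close>; it carries the same
  topology.\<close>

definition Theta :: "((real^'n::finite) \<times> 'n vec2) set" where
  "Theta = {(d, v). \<forall>i. d $ i > 0}"

definition star_rel ::
  "(((real^'n::finite) \<times> 'n vec2) \<times> ((real^'n) \<times> 'n vec2)) set" where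
  "star_rel = {((d1, v1), (d2, v2)). (d1, v1) \<in> Theta \<and> (d2, v2) \<in> Theta \<and>
     (\<exists>\<sigma> A. \<sigma> permutes UNIV \<and> invertible A \<and>
        perm2 \<sigma> ** diag2 d1 ** transpose (perm2 \<sigma>) = diag2 d2 \<and>
        (transpose A ** diag2 d1 ** A) *v v1 = diag2 d1 *v v1 \<and>
        A ** JJ ** diag2 d1 = JJ ** diag2 d1 ** A \<and>
        v2 = (perm2 \<sigma> ** A) *v v1)}"

definition param_map :: "('n::finite) mat2 \<Rightarrow> (real^'n) \<times> 'n vec2 \<Rightarrow>
    'n mat2 \<times> 'n vec2" where
  "param_map S = (\<lambda>(d, v). (transpose S ** diag2 d ** S, matrix_inv S *v v))"

subsection \<open>The two relations are equivalence relations\<close>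

lemma block_matrix_mult:
  fixes A B C D A' B' C' D' :: "real^'n::finite^'n"
  shows "block_matrix A B C D ** block_matrix A' B' C' D' =
    block_matrix (A ** A' + B ** C') (A ** B' + B ** D') (C ** A' + D ** C') (C ** B' + D ** D')"
  by (auto simp: vec_eq_iff matrix_matrix_mult_def block_matrix_def UNIV_Plus_UNIV[symmetric]
      sum.Plus split: sum.splits simp del: UNIV_Plus_UNIV)

lemma block_matrix_transpose:
  "transpose (block_matrix A B C D) =
     block_matrix (transpose A) (transpose C) (transpose B) (transpose D)"
  by (auto simp: vec_eq_iff transpose_def block_matrix_def split: sum.splits)

lemma block_matrix_one: "block_matrix (mat 1) 0 0 (mat 1) = mat 1"
  by (auto simp: vec_eq_iff mat_def block_matrix_def split: sum.splits)

lemma perm_matrix_mult: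
  fixes \<sigma> \<tau> :: "'n::finite \<Rightarrow> 'n"
  shows "perm_matrix \<sigma> ** perm_matrix \<tau> = perm_matrix (\<sigma> \<circ> \<tau>)"
proof -
  have "(\<Sum>k\<in>UNIV. (if i = \<sigma> k then 1 else 0) * (if k = \<tau> j then 1 else 0)) =
      (if i = \<sigma> (\<tau> j) then 1 else (0::real))" for i j
    by (subst sum.mono_neutral_right[of _ "{\<tau> j}"]) auto
  then show ?thesis
    by (simp add: vec_eq_iff matrix_matrix_mult_def perm_matrix_def)
qed

lemma perm_matrix_id: "perm_matrix id = mat 1"
  by (auto simp: vec_eq_iff perm_matrix_def mat_def)

lemma perm_matrix_transpose:
  assumes "\<sigma> permutes UNIV"
  shows "transpose (perm_matrix \<sigma>) = perm_matrix (inv \<sigma>)"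
  by (auto simp: vec_eq_iff perm_matrix_def transpose_def permutes_inverses[OF assms])

lemma perm2_mult:
  fixes \<sigma> \<tau> :: "'n::finite \<Rightarrow> 'n"
  shows "perm2 \<sigma> ** perm2 \<tau> = perm2 (\<sigma> \<circ> \<tau>)"
  by (simp add: perm2_def block_matrix_mult perm_matrix_mult)

lemma perm2_id: "perm2 id = mat 1"
  by (simp add: perm2_def perm_matrix_id block_matrix_one)

lemma transpose_zero: "transpose 0 = (0 :: real^'n^'n)"
  by (simp add: vec_eq_iff transpose_def)

lemma perm2_transpose:
  assumes "\<sigma> permutes UNIV"
  shows "transpose (perm2 \<sigma>) = perm2 (inv \<sigma>)"
  by (simp add: perm2_def block_matrix_transpose perm_matrix_transpose[OF assms] transpose_zero)

lemma perm2_inverses: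
  fixes \<sigma> :: "'n::finite \<Rightarrow> 'n"
  assumes "\<sigma> permutes UNIV"
  shows "perm2 \<sigma> ** transpose (perm2 \<sigma>) = mat 1" "transpose (perm2 \<sigma>) ** perm2 \<sigma> = mat 1"
  by (simp_all add: perm2_transpose[OF assms] perm2_mult permutes_inv_o[OF assms] perm2_id)

lemma perm2_JJ:
  fixes \<sigma> :: "'n::finite \<Rightarrow> 'n"
  shows "perm2 \<sigma> ** JJ = JJ ** perm2 \<sigma>"
proof -
  have "perm_matrix \<sigma> ** (- mat 1) = - perm_matrix \<sigma>" "(- mat 1) ** perm_matrix \<sigma> = - perm_matrix \<sigma>"
    by (simp_all add: vec_eq_iff matrix_matrix_mult_def mat_def if_distrib if_distribR
        sum.delta sum_negf cong: if_cong)
  then show ?thesis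
    by (simp add: perm2_def JJ_def block_matrix_mult)
qed

text \<open>The map \<open>L = P A\<close> turns the conditions defining \<open>star_rel\<close> into those defining \<open>sys_rel\<close>
  for diagonal systems, up to the requirement that \<open>P\<close> conjugates the two diagonal matrices.\<close>

lemma star_rel_iff:
  fixes d1 d2 :: "real^'n::finite" and v1 v2 :: "'n vec2"
  shows "((d1, v1), (d2, v2)) \<in> star_rel \<longleftrightarrow>
    (d1, v1) \<in> Theta \<and> (d2, v2) \<in> Theta \<and>
    (\<exists>\<sigma>. \<sigma> permutes UNIV \<and> perm2 \<sigma> ** diag2 d1 ** transpose (perm2 \<sigma>) = diag2 d2) \<and>
    (\<exists>L. invertible L \<and> L ** JJ ** diag2 d1 = JJ ** diag2 d2 ** L \<and> L *v v1 = v2 \<and>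
       diag2 d1 *v v1 = (transpose L ** diag2 d2) *v v2)" (is "?lhs \<longleftrightarrow> ?rhs")
proof
  assume ?lhs
  then obtain \<sigma> A where 0: "(d1, v1) \<in> Theta" "(d2, v2) \<in> Theta"
    and s: "\<sigma> permutes UNIV" and A: "invertible A"
    and i: "perm2 \<sigma> ** diag2 d1 ** transpose (perm2 \<sigma>) = diag2 d2"
    and ii: "(transpose A ** diag2 d1 ** A) *v v1 = diag2 d1 *v v1"
    and iii: "A ** JJ ** diag2 d1 = JJ ** diag2 d1 ** A"
    and iv: "v2 = (perm2 \<sigma> ** A) *v v1"
    by (auto simp: star_rel_def)
  define P where "P = perm2 \<sigma>"
  have P: "P ** transpose P = mat 1" "transpose P ** P = mat 1"
    using perm2_inverses[OF s] by (simp_all add: P_def)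
  have PJ: "P ** JJ = JJ ** P" by (simp add: P_def perm2_JJ)
  note i = i[folded P_def]
  have i': "diag2 d2 ** P = P ** diag2 d1"
    unfolding i[symmetric] by (simp add: matrix_mul_assoc[symmetric] P)
  have i2: "transpose P ** diag2 d2 ** P = diag2 d1"
    by (simp add: matrix_mul_assoc[symmetric] i') (simp add: matrix_mul_assoc P)
  have "invertible P" using P by (auto simp: invertible_def)
  then have L: "invertible (P ** A)" using A by (rule invertible_mult)
  have "P ** A ** JJ ** diag2 d1 = P ** (A ** JJ ** diag2 d1)"
    by (simp add: matrix_mul_assoc)
  also have "\<dots> = P ** JJ ** diag2 d1 ** A" by (simp add: iii matrix_mul_assoc)
  also have "\<dots> = JJ ** (P ** diag2 d1) ** A" by (simp add: PJ matrix_mul_assoc)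
  also have "\<dots> = JJ ** diag2 d2 ** (P ** A)" by (simp add: i'[symmetric] matrix_mul_assoc)
  finally have 1: "P ** A ** JJ ** diag2 d1 = JJ ** diag2 d2 ** (P ** A)" .
  have "(transpose (P ** A) ** diag2 d2) *v v2 =
      (transpose A ** (transpose P ** diag2 d2 ** P) ** A) *v v1"
    by (simp add: iv[folded P_def] matrix_transpose_mul matrix_mul_assoc matrix_vector_mul_assoc)
  also have "\<dots> = diag2 d1 *v v1" by (simp add: i2 ii)
  finally show ?rhs using 0 s i L 1 iv unfolding P_def by metis
next
  assume ?rhs
  then obtain \<sigma> L where 0: "(d1, v1) \<in> Theta" "(d2, v2) \<in> Theta"
    and s: "\<sigma> permutes UNIV" and L: "invertible L"
    and i: "perm2 \<sigma> ** diag2 d1 ** transpose (perm2 \<sigma>) = diag2 d2"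
    and L1: "L ** JJ ** diag2 d1 = JJ ** diag2 d2 ** L"
    and L2: "L *v v1 = v2" and L3: "diag2 d1 *v v1 = (transpose L ** diag2 d2) *v v2"
    by auto
  define P where "P = perm2 \<sigma>"
  have P: "P ** transpose P = mat 1" "transpose P ** P = mat 1"
    using perm2_inverses[OF s] by (simp_all add: P_def)
  have PJ: "P ** JJ = JJ ** P" by (simp add: P_def perm2_JJ)
  note i = i[folded P_def]
  define A where "A = transpose P ** L"
  have LA: "L = P ** A" by (simp add: A_def matrix_mul_assoc P)
  have PJ': "transpose P ** JJ = JJ ** transpose P"
  proof -
    have "transpose P ** JJ = transpose P ** (JJ ** P) ** transpose P"
      by (simp add: matrix_mul_assoc[symmetric] P)
    also have "\<dots> = transpose P ** P ** JJ ** transpose P"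
      by (simp add: PJ[symmetric] matrix_mul_assoc)
    finally show ?thesis by (simp add: P)
  qed
  have i': "transpose P ** diag2 d2 = diag2 d1 ** transpose P"
    unfolding i[symmetric] by (simp add: matrix_mul_assoc P)
  have "invertible (transpose P)" using P by (auto simp: invertible_def)
  then have A: "invertible A" unfolding A_def using L by (rule invertible_mult)
  have "A ** JJ ** diag2 d1 = transpose P ** (L ** JJ ** diag2 d1)"
    by (simp add: A_def matrix_mul_assoc)
  also have "\<dots> = (transpose P ** JJ) ** diag2 d2 ** L"
    by (simp add: L1 matrix_mul_assoc)
  also have "\<dots> = JJ ** (transpose P ** diag2 d2) ** L"
    by (simp add: PJ' matrix_mul_assoc)
  also have "\<dots> = JJ ** diag2 d1 ** A"
    by (simp add: i' A_def matrix_mul_assoc)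
  finally have iii: "A ** JJ ** diag2 d1 = JJ ** diag2 d1 ** A" .
  have "diag2 d1 *v v1 = (transpose A ** (transpose P ** diag2 d2) ** P ** A) *v v1"
    by (simp add: L3 L2[symmetric] LA matrix_transpose_mul matrix_mul_assoc matrix_vector_mul_assoc)
  also have "\<dots> = (transpose A ** diag2 d1 ** (transpose P ** P) ** A) *v v1"
    by (simp only: i' matrix_mul_assoc)
  finally have ii: "(transpose A ** diag2 d1 ** A) *v v1 = diag2 d1 *v v1" by (simp add: P)
  have "v2 = (P ** A) *v v1" using L2 LA by simp
  then show ?lhs using 0 s i A ii iii unfolding star_rel_def P_def by blast
qed

text \<open>The conditions on \<open>L\<close> shared by the two relations.\<close>

definition sys_iso :: "('n::finite) mat2 \<Rightarrow> 'n mat2 \<Rightarrow>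
    'n vec2 \<Rightarrow> 'n mat2 \<Rightarrow> 'n vec2 \<Rightarrow> bool" where
  "sys_iso L Q1 B1 Q2 B2 \<longleftrightarrow> invertible L \<and> L ** JJ ** Q1 = JJ ** Q2 ** L \<and> L *v B1 = B2 \<and>
     B1 v* Q1 = B2 v* (Q2 ** L)"

lemma sys_iso_refl: "sys_iso (mat 1) Q B Q B"
  by (auto simp: sys_iso_def invertible_def intro: exI[of _ "mat 1"])

lemma sys_iso_sym:
  assumes "sys_iso L Q1 B1 Q2 B2"
  shows "sys_iso (matrix_inv L) Q2 B2 Q1 B1"
proof -
  define M where "M = matrix_inv L"
  have L: "invertible L" and 1: "L ** JJ ** Q1 = JJ ** Q2 ** L" and 2: "L *v B1 = B2"
    and 3: "B1 v* Q1 = B2 v* (Q2 ** L)"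
    using assms by (auto simp: sys_iso_def)
  have M: "M ** L = mat 1" "L ** M = mat 1"
    using L someI_ex[of "\<lambda>B. L ** B = mat 1 \<and> B ** L = mat 1"]
    by (simp_all add: M_def matrix_inv_def invertible_def)
  have "M ** JJ ** Q2 = M ** (JJ ** Q2 ** L) ** M"
    by (simp add: matrix_mul_assoc[symmetric] M)
  also have "\<dots> = (M ** L) ** JJ ** Q1 ** M"
    by (simp add: 1[symmetric] matrix_mul_assoc)
  finally have "M ** JJ ** Q2 = JJ ** Q1 ** M" by (simp add: M)
  moreover have "M *v B2 = B1"
    by (simp add: 2[symmetric] matrix_vector_mul_assoc M)
  moreover have "B1 v* (Q1 ** M) = B2 v* Q2"
  proof -
    have "B1 v* (Q1 ** M) = (B1 v* Q1) v* M" by (simp add: vector_matrix_mul_assoc)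
    also have "\<dots> = B2 v* (Q2 ** (L ** M))"
      by (simp add: 3 vector_matrix_mul_assoc matrix_mul_assoc)
    finally show ?thesis by (simp add: M)
  qed
  moreover have "invertible M" using M by (auto simp: invertible_def)
  ultimately show ?thesis by (simp add: sys_iso_def M_def)
qed

lemma sys_iso_trans:
  assumes "sys_iso L Q1 B1 Q2 B2" "sys_iso M Q2 B2 Q3 B3"
  shows "sys_iso (M ** L) Q1 B1 Q3 B3"
proof -
  have L: "invertible L" "L ** JJ ** Q1 = JJ ** Q2 ** L" "L *v B1 = B2" "B1 v* Q1 = B2 v* (Q2 ** L)"
    using assms(1) by (auto simp: sys_iso_def)
  have M: "invertible M" "M ** JJ ** Q2 = JJ ** Q3 ** M" "M *v B2 = B3" "B2 v* Q2 = B3 v* (Q3 ** M)"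
    using assms(2) by (auto simp: sys_iso_def)
  have "M ** L ** JJ ** Q1 = M ** (L ** JJ ** Q1)" by (simp add: matrix_mul_assoc)
  also have "\<dots> = (M ** JJ ** Q2) ** L" by (simp add: L(2) matrix_mul_assoc)
  also have "\<dots> = JJ ** Q3 ** (M ** L)" by (simp add: M(2) matrix_mul_assoc)
  finally have "M ** L ** JJ ** Q1 = JJ ** Q3 ** (M ** L)" .
  moreover have "B1 v* Q1 = (B2 v* Q2) v* L" by (simp add: L(4) vector_matrix_mul_assoc)
  then have "B1 v* Q1 = B3 v* (Q3 ** (M ** L))"
    by (simp add: M(4) vector_matrix_mul_assoc matrix_mul_assoc)
  moreover have "(M ** L) *v B1 = B3"
    using L(3) M(3) by (simp add: matrix_vector_mul_assoc[symmetric])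
  ultimately show ?thesis using L(1) M(1) by (simp add: sys_iso_def invertible_mult)
qed

lemma equiv_sys_rel: "equiv PH sys_rel"
proof (rule equivI)
  have eq: "sys_rel = {((Q1, B1), (Q2, B2)). (Q1, B1) \<in> PH \<and> (Q2, B2) \<in> PH \<and>
      (\<exists>L. sys_iso L Q1 B1 Q2 B2)}"
    unfolding sys_rel_def sys_iso_def by simp
  show "sys_rel \<subseteq> PH \<times> PH" by (auto simp: eq)
  show "refl_on PH sys_rel" using sys_iso_refl by (auto simp: eq refl_on_def)
  show "sym sys_rel" using sys_iso_sym by (fastforce simp: eq sym_def)
  show "trans sys_rel"
    unfolding eq trans_def using sys_iso_trans by (clarsimp, blast)
qed

lemma star_rel_iff':
  fixes d1 d2 :: "real^'n::finite" and v1 v2 :: "'n vec2"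
  shows "((d1, v1), (d2, v2)) \<in> star_rel \<longleftrightarrow>
    (d1, v1) \<in> Theta \<and> (d2, v2) \<in> Theta \<and>
    (\<exists>\<sigma>. \<sigma> permutes UNIV \<and> perm2 \<sigma> ** diag2 d1 ** transpose (perm2 \<sigma>) = diag2 d2) \<and>
    (\<exists>L. sys_iso L (diag2 d1) v1 (diag2 d2) v2)"
proof -
  have tr: "transpose (diag2 d) = diag2 d" for d :: "real^'n"
  proof -
    have "transpose (diag d) = diag d" by (auto simp: vec_eq_iff transpose_def diag_def)
    then show ?thesis by (simp add: diag2_def block_matrix_transpose transpose_zero)
  qed
  have "v1 v* diag2 d1 = diag2 d1 *v v1"
    by (metis tr vector_transpose_matrix)
  moreover have "v2 v* (diag2 d2 ** L) = (transpose L ** diag2 d2) *v v2" for L :: "'n mat2"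
    by (metis matrix_transpose_mul tr transpose_matrix_vector)
  ultimately show ?thesis unfolding star_rel_iff sys_iso_def by simp
qed

lemma equiv_star_rel: "equiv (Theta :: ((real^'n::finite) \<times> 'n vec2) set) star_rel"
proof (rule equivI)
  show "star_rel \<subseteq> Theta \<times> (Theta :: ((real^'n) \<times> 'n vec2) set)"
    by (auto simp: star_rel_iff')
  show "refl_on Theta (star_rel :: (((real^'n) \<times> 'n vec2) \<times> _) set)"
  proof (rule refl_onI, clarify)
    fix d :: "real^'n" and v :: "'n vec2"
    assume "(d, v) \<in> Theta"
    moreover have "perm2 id ** diag2 d ** transpose (perm2 id) = diag2 d"
      by (simp add: perm2_id transpose_mat)
    ultimately show "((d, v), (d, v)) \<in> star_rel"
      unfolding star_rel_iff' using sys_iso_refl permutes_id by blast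
  qed
  show "sym (star_rel :: (((real^'n) \<times> 'n vec2) \<times> _) set)"
  proof (rule symI, clarify)
    fix d1 d2 :: "real^'n" and v1 v2 :: "'n vec2"
    assume *: "((d1, v1), (d2, v2)) \<in> star_rel"
    then obtain \<sigma> where s: "\<sigma> permutes UNIV"
      and i: "perm2 \<sigma> ** diag2 d1 ** transpose (perm2 \<sigma>) = diag2 d2"
      by (auto simp: star_rel_iff')
    have "transpose (perm2 \<sigma>) ** diag2 d2 ** perm2 \<sigma> =
        (transpose (perm2 \<sigma>) ** perm2 \<sigma>) ** diag2 d1 ** (transpose (perm2 \<sigma>) ** perm2 \<sigma>)"
      unfolding i[symmetric] by (simp only: matrix_mul_assoc)
    then have "perm2 (inv \<sigma>) ** diag2 d2 ** transpose (perm2 (inv \<sigma>)) = diag2 d1"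
      by (simp add: perm2_inverses[OF s] perm2_transpose[OF s, symmetric] transpose_transpose)
    then show "((d2, v2), (d1, v1)) \<in> star_rel"
      using * sys_iso_sym permutes_inv[OF s] unfolding star_rel_iff' by blast
  qed
  show "trans (star_rel :: (((real^'n) \<times> 'n vec2) \<times> _) set)"
  proof (rule transI, clarify)
    fix d1 d2 d3 :: "real^'n" and v1 v2 v3 :: "'n vec2"
    assume *: "((d1, v1), (d2, v2)) \<in> star_rel" "((d2, v2), (d3, v3)) \<in> star_rel"
    then obtain \<sigma> \<tau> where s: "\<sigma> permutes UNIV" "\<tau> permutes UNIV"
      and i: "perm2 \<sigma> ** diag2 d1 ** transpose (perm2 \<sigma>) = diag2 d2"
        "perm2 \<tau> ** diag2 d2 ** transpose (perm2 \<tau>) = diag2 d3"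
      by (auto simp: star_rel_iff')
    have "perm2 (\<tau> \<circ> \<sigma>) ** diag2 d1 ** transpose (perm2 (\<tau> \<circ> \<sigma>)) = diag2 d3"
      unfolding i(2)[symmetric] i(1)[symmetric] perm2_mult[symmetric] matrix_transpose_mul
      by (simp only: matrix_mul_assoc)
    then show "((d1, v1), (d3, v3)) \<in> star_rel"
      using * sys_iso_trans permutes_compose[OF s] unfolding star_rel_iff' by blast
  qed
qed

end

theory Submission
  imports Defs
begin

text \<open>Williamson's normal form gives every \<open>Q\<close> as \<open>S\<^sup>T diag2 d S\<close> with \<open>S\<close> symplectic, and \<open>S\<close> is then a
  system isomorphism from \<open>(Q, B)\<close> to \<open>(diag2 d, S B)\<close>; so the induced map is onto and independent of
  \<open>S\<close>. It is injective since an isomorphism \<open>L\<close> between diagonal systems intertwines the squares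
  \<open>(JJ diag2 d)\<^sup>2 = - (diag2 d)\<^sup>2\<close>, and a nonzero term of \<open>det L\<close> matches the entries of the two diagonals.
  It is closed since, along a convergent sequence \<open>Q k\<close> with positive definite limit, the Williamson
  matrices and the symplectic eigenvalues stay in a compact set.\<close>

subsection \<open>Symplectic bases adapted to an inner product\<close>

text \<open>Near \<open>0\<close> the linear term dominates. With
  \<open>c = \<bar>a\<bar> + 1\<close>, the point \<open>t = - b / c\<close> gives the value
  \<open>(b / c)^2 * (a - c)\<close>, which is negative unless \<open>b = 0\<close>.\<close>

lemma quadratic_nonneg_imp_linear_zero:
  fixes a b :: real
  assumes "\<And>t. a * t\<^sup>2 + b * t \<ge> 0"
  shows "b = 0"
proof (rule ccontr)
  assume "b \<noteq> 0"
  define c where "c = \<bar>a\<bar> + 1"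
  have c: "c > 0" "a < c" by (auto simp: c_def)
  have "a * (- b / c)\<^sup>2 + b * (- b / c) = (b\<^sup>2 / c\<^sup>2) * (a - c)"
    using c by (simp add: field_simps power2_eq_square)
  also have "\<dots> < 0" using c \<open>b \<noteq> 0\<close> by (intro mult_pos_neg) auto
  finally show False using assms[of "- b / c"] by simp
qed

text \<open>A Lagrange condition in Riesz form: \<open>x\<close> attains the \<open>q\<close>-norm
  \<open>\<mu>\<close> of the functional on \<open>V\<close>, so the bound \<open>le\<close>,
  expanded to first order along \<open>x + t *\<^sub>R z\<close>, shows that
  \<open>\<mu> *\<^sub>R x\<close> represents the functional on \<open>V\<close>.\<close>

lemma extremal_functional:
  fixes q :: "'a::euclidean_space \<Rightarrow> 'a \<Rightarrow> real"
  assumes q: "bounded_bilinear q" and sym: "\<And>x y. q x y = q y x"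
    and V: "subspace V" and \<phi>: "linear \<phi>"
    and le: "\<And>u. u \<in> V \<Longrightarrow> (\<phi> u)\<^sup>2 \<le> \<mu>\<^sup>2 * q u u"
    and x: "x \<in> V" "\<phi> x = \<mu>" "q x x \<le> 1" and \<mu>: "\<mu> > 0" and z: "z \<in> V"
  shows "\<phi> z = \<mu> * q x z"
proof -
  interpret q: bounded_bilinear q by (rule q)
  have "\<mu>\<^sup>2 * 1 \<le> \<mu>\<^sup>2 * q x x" using le[OF x(1)] x(2) by simp
  then have "q x x = 1" using x(3) \<mu> by (simp add: mult_le_cancel_left)
  \<comment> \<open>This is the bound at \<open>x + t *\<^sub>R z\<close>; its constant terms cancel
    because \<open>\<phi> x = \<mu>\<close> and \<open>q x x = 1\<close>.\<close>
  have "(\<mu>\<^sup>2 * q z z - (\<phi> z)\<^sup>2) * t\<^sup>2 + 2 * \<mu> * (\<mu> * q x z - \<phi> z) * t \<ge> 0" for t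
  proof -
    have "x + t *\<^sub>R z \<in> V" using V x(1) z by (simp add: subspace_add subspace_scale)
    from le[OF this] have "(\<mu> + t * \<phi> z)\<^sup>2 \<le> \<mu>\<^sup>2 * (1 + 2 * t * q x z + t * (t * q z z))"
      using \<open>q x x = 1\<close>
      by (simp add: linear_add[OF \<phi>] linear_scale[OF \<phi>] x(2) q.add_left q.add_right
          q.scaleR_left q.scaleR_right sym[of z x] algebra_simps)
    then show ?thesis by (simp add: power2_eq_square algebra_simps)
  qed
  then have "2 * \<mu> * (\<mu> * q x z - \<phi> z) = 0" by (rule quadratic_nonneg_imp_linear_zero)
  then show ?thesis using \<mu> by simp
qed

text \<open>The constant is the minimum of \<open>q x x\<close> over the compact unit sphere;
  homogeneity carries the bound to all vectors.\<close>

lemma pos_def_coercive: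
  fixes q :: "'a::euclidean_space \<Rightarrow> 'a \<Rightarrow> real"
  assumes q: "bounded_bilinear q" and pos: "\<And>x. x \<noteq> 0 \<Longrightarrow> q x x > 0"
  obtains c where "c > 0" "\<And>x. c * (norm x)\<^sup>2 \<le> q x x"
proof -
  interpret q: bounded_bilinear q by (rule q)
  have "continuous_on (sphere 0 1) (\<lambda>x. q x x)"
    by (intro q.continuous_on continuous_on_id)
  moreover obtain b :: 'a where "b \<in> Basis" using nonempty_Basis by blast
  then have "sphere (0::'a) 1 \<noteq> {}" by (auto intro!: exI[of _ b])
  ultimately obtain x0 where x0: "x0 \<in> sphere 0 1" "\<And>y. y \<in> sphere 0 1 \<Longrightarrow> q x0 x0 \<le> q y y"
    using continuous_attains_inf[OF compact_sphere] by blast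
  have "q x0 x0 * (norm x)\<^sup>2 \<le> q x x" for x
  proof (cases "x = 0")
    case False
    have "q x0 x0 \<le> q (x /\<^sub>R norm x) (x /\<^sub>R norm x)" using False by (intro x0(2)) simp
    then show ?thesis using False
      by (simp add: q.scaleR_left q.scaleR_right field_simps power2_eq_square)
  qed (simp add: q.zero_left)
  moreover have "q x0 x0 > 0" using x0(1) by (intro pos) auto
  ultimately show ?thesis using that by blast
qed

text \<open>The pair maximises \<open>w x y\<close> over the product of two \<open>q\<close>-unit balls of \<open>V\<close>, rescaled; the last two
  conclusions are the Lagrange conditions.\<close>

lemma symplectic_pair_exists:
  fixes q w :: "'a::euclidean_space \<Rightarrow> 'a \<Rightarrow> real"
  assumes q: "bounded_bilinear q" and sym: "\<And>x y. q x y = q y x"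
    and pos: "\<And>x. x \<noteq> 0 \<Longrightarrow> q x x > 0"
    and w: "bounded_bilinear w" and V: "subspace V" and nz: "\<exists>x\<in>V. \<exists>y\<in>V. w x y \<noteq> 0"
  obtains e f d where "e \<in> V" "f \<in> V" "d > 0" "w e f = 1"
    "\<And>z. z \<in> V \<Longrightarrow> q z e = d * w z f" "\<And>z. z \<in> V \<Longrightarrow> q z f = d * w e z"
proof -
  interpret q: bounded_bilinear q by (rule q)
  interpret w: bounded_bilinear w by (rule w)
  obtain c where c: "c > 0" "\<And>x. c * (norm x)\<^sup>2 \<le> q x x"
    using pos_def_coercive[OF q pos] by blast
  \<comment> \<open>The \<open>q\<close>-unit ball of \<open>V\<close>: closed because
    \<open>q\<close> is continuous, bounded by coercivity, hence compact, so that \<open>w\<close>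
    attains a maximum on \<open>K \<times> K\<close>.\<close>
  define K where "K = V \<inter> {x. q x x \<le> 1}"
  have "closed K" unfolding K_def
    by (intro closed_Int closed_subspace V closed_Collect_le q.continuous_on continuous_on_id
        continuous_on_const)
  moreover have "bounded K" unfolding bounded_iff
  proof (intro exI ballI)
    fix x assume "x \<in> K"
    then have "(norm x)\<^sup>2 \<le> (sqrt (1 / c))\<^sup>2"
      using c(2)[of x] c(1) by (simp add: K_def field_simps real_sqrt_divide)
    then show "norm x \<le> sqrt (1 / c)" using c(1) by (meson power2_le_imp_le real_sqrt_ge_zero
        divide_nonneg_pos zero_le_one)
  qed
  ultimately have "compact K" by (simp add: compact_eq_bounded_closed)
  then have K: "compact (K \<times> K)" by (intro compact_Times)
  have "0 \<in> K" using V by (simp add: K_def subspace_0 q.zero_left)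
  then have ne: "K \<times> K \<noteq> {}" by blast
  have "continuous_on (K \<times> K) (\<lambda>p. w (fst p) (snd p))"
    by (intro w.continuous_on continuous_intros)
  from continuous_attains_sup[OF K ne this] obtain x y where xy: "x \<in> K" "y \<in> K"
    and max: "\<And>x' y'. x' \<in> K \<Longrightarrow> y' \<in> K \<Longrightarrow> w x' y' \<le> w x y" by force
  define \<mu> where "\<mu> = w x y"
  have unit: "u /\<^sub>R sqrt (q u u) \<in> K" if "u \<in> V" "u \<noteq> 0" for u
    using that V pos[of u]
    by (simp add: K_def subspace_scale q.scaleR_left q.scaleR_right field_simps)
  have neg: "- u \<in> K" if "u \<in> K" for u
    using that V by (simp add: K_def subspace_neg q.minus_left q.minus_right)
  have \<mu>: "\<mu> > 0"
  proof -
    obtain a b where ab: "a \<in> V" "b \<in> V" "w a b \<noteq> 0" using nz by blast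
    then have "a \<noteq> 0" "b \<noteq> 0" by (auto simp: w.zero_left w.zero_right)
    \<comment> \<open>Both signs of \<open>a'\<close> lie in \<open>K\<close>, so a nonzero value of
      \<open>w\<close> there forces the maximum to be positive.\<close>
    define a' b' where "a' = a /\<^sub>R sqrt (q a a)" and "b' = b /\<^sub>R sqrt (q b b)"
    have "w a' b' \<noteq> 0"
      using ab(3) pos[OF \<open>a \<noteq> 0\<close>] pos[OF \<open>b \<noteq> 0\<close>]
      by (simp add: a'_def b'_def w.scaleR_left w.scaleR_right)
    moreover have "w a' b' \<le> \<mu>" "w (- a') b' \<le> \<mu>"
      unfolding \<mu>_def a'_def b'_def using ab \<open>a \<noteq> 0\<close> \<open>b \<noteq> 0\<close> by (auto intro!: max unit neg)
    ultimately show ?thesis by (auto simp: w.minus_left)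
  qed
  \<comment> \<open>With \<open>y\<close> fixed, maximality bounds \<open>w u y\<close> on the unit
    ball; rescaling gives the quadratic bound required by \<open>extremal_functional\<close>. The
    next fact does the same with \<open>x\<close> fixed.\<close>
  have lex: "(w u y)\<^sup>2 \<le> \<mu>\<^sup>2 * q u u" if "u \<in> V" for u
  proof (cases "u = 0")
    case False
    define u' where "u' = u /\<^sub>R sqrt (q u u)"
    have "u' \<in> K" unfolding u'_def using that False by (rule unit)
    then have "w u' y \<le> \<mu>" "w (- u') y \<le> \<mu>" unfolding \<mu>_def by (auto intro: max neg xy)
    then have "(w u' y)\<^sup>2 \<le> \<mu>\<^sup>2" by (intro abs_le_square_iff[THEN iffD1]) (auto simp: w.minus_left)
    then show ?thesis using pos[OF False]
      by (simp add: u'_def w.scaleR_left power_divide power_mult_distrib field_simps)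
  qed (simp add: w.zero_left q.zero_left)
  have ley: "(w x u)\<^sup>2 \<le> \<mu>\<^sup>2 * q u u" if "u \<in> V" for u
  proof (cases "u = 0")
    case False
    define u' where "u' = u /\<^sub>R sqrt (q u u)"
    have "u' \<in> K" unfolding u'_def using that False by (rule unit)
    then have "w x u' \<le> \<mu>" "w x (- u') \<le> \<mu>" unfolding \<mu>_def by (auto intro: max neg xy)
    then have "(w x u')\<^sup>2 \<le> \<mu>\<^sup>2" by (intro abs_le_square_iff[THEN iffD1]) (auto simp: w.minus_right)
    then show ?thesis using pos[OF False]
      by (simp add: u'_def w.scaleR_right power_divide power_mult_distrib field_simps)
  qed (simp add: w.zero_right q.zero_left)
  have xV: "x \<in> V" "q x x \<le> 1" and yV: "y \<in> V" "q y y \<le> 1" using xy by (auto simp: K_def)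
  have ex: "w z y = \<mu> * q x z" if "z \<in> V" for z
    using extremal_functional[OF q sym V _ lex xV(1) _ xV(2) \<mu> that]
      w.bounded_linear_left[THEN bounded_linear.linear] \<mu>_def by blast
  have ey: "w x z = \<mu> * q y z" if "z \<in> V" for z
    using extremal_functional[OF q sym V _ ley yV(1) _ yV(2) \<mu> that]
      w.bounded_linear_right[THEN bounded_linear.linear] \<mu>_def by blast
  \<comment> \<open>Scaling both vectors by \<open>s\<close> turns \<open>w x y = \<mu>\<close> into
    \<open>1\<close>, and dividing the Lagrange identities by \<open>\<mu>\<close> gives the factor
    \<open>d = 1 / \<mu>\<close>.\<close>
  define s where "s = sqrt (1 / \<mu>)"
  have s: "s * s = 1 / \<mu>" "s \<noteq> 0" using \<mu> by (auto simp: s_def)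
  show ?thesis
  proof (rule that[of "s *\<^sub>R x" "s *\<^sub>R y" "1 / \<mu>"])
    show "s *\<^sub>R x \<in> V" "s *\<^sub>R y \<in> V" using V xV yV by (auto simp: subspace_scale)
    show "1 / \<mu> > 0" using \<mu> by simp
    show "w (s *\<^sub>R x) (s *\<^sub>R y) = 1" using s \<mu>
      by (simp add: w.scaleR_left w.scaleR_right mult.assoc[symmetric] \<mu>_def)
    show "q z (s *\<^sub>R x) = 1 / \<mu> * w z (s *\<^sub>R y)" if "z \<in> V" for z
      using \<mu> ex[OF that] by (simp add: q.scaleR_right w.scaleR_right sym[of z x])
    show "q z (s *\<^sub>R y) = 1 / \<mu> * w (s *\<^sub>R x) z" if "z \<in> V" for z
      using \<mu> ey[OF that] by (simp add: q.scaleR_right w.scaleR_left sym[of z y])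
  qed
qed

text \<open>Pairs are split off one at a time. The next pair comes from the
  \<open>w\<close>-complement \<open>V\<close> of the pairs already found; their defining relations
  make \<open>V\<close> also \<open>q\<close>-orthogonal to them, so the relations of the new pair
  extend from \<open>V\<close> to the whole space.\<close>

lemma symplectic_family_exists:
  fixes q w :: "'a::euclidean_space \<Rightarrow> 'a \<Rightarrow> real" and I :: "'i set"
  assumes q: "bounded_bilinear q" and sym: "\<And>x y. q x y = q y x"
    and pos: "\<And>x. x \<noteq> 0 \<Longrightarrow> q x x > 0"
    and w: "bounded_bilinear w" and alt: "\<And>x y. w x y = - w y x"
    and nondeg: "\<And>x. x \<noteq> 0 \<Longrightarrow> \<exists>y. w x y \<noteq> 0"
    and I: "finite I" "2 * card I \<le> DIM('a)"
  shows "\<exists>e f d. (\<forall>i\<in>I. d i > 0 \<and> (\<forall>z. q z (e i) = d i * w z (f i)) \<and>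
             (\<forall>z. q z (f i) = d i * w (e i) z)) \<and>
           (\<forall>i\<in>I. \<forall>j\<in>I. w (e i) (f j) = (if i = j then 1 else 0) \<and>
             w (e i) (e j) = 0 \<and> w (f i) (f j) = 0)"
  using I
proof (induction I)
  case empty
  then show ?case by simp
next
  case (insert k I)
  interpret q: bounded_bilinear q by (rule q)
  interpret w: bounded_bilinear w by (rule w)
  have ww: "w x x = 0" for x using alt[of x x] by simp
  have "2 * card I \<le> DIM('a)" using insert by simp
  from insert.IH[OF this] obtain e f d where
    1: "\<forall>i\<in>I. d i > 0 \<and> (\<forall>z. q z (e i) = d i * w z (f i)) \<and> (\<forall>z. q z (f i) = d i * w (e i) z)"
    and 2: "\<forall>i\<in>I. \<forall>j\<in>I. w (e i) (f j) = (if i = j then 1 else 0) \<and>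
      w (e i) (e j) = 0 \<and> w (f i) (f j) = 0"
    by blast
  have d: "d i > 0" and qe: "q z (e i) = d i * w z (f i)" and qf: "q z (f i) = d i * w (e i) z"
    if "i \<in> I" for i z
    using 1 that by auto
  have ef: "w (e i) (f j) = (if i = j then 1 else 0)" and ee: "w (e i) (e j) = 0"
    and ff: "w (f i) (f j) = 0" if "i \<in> I" "j \<in> I" for i j
    using 2 that by auto
  define V where "V = {x. \<forall>i\<in>I. w x (e i) = 0 \<and> w x (f i) = 0}"
  have V: "subspace V"
    unfolding subspace_def V_def by (simp add: w.zero_left w.add_left w.scaleR_left)
  \<comment> \<open>The \<open>w\<close>-projection onto the span of the pairs found so far, written
    in the symplectic basis.\<close>
  define p where "p z = (\<Sum>i\<in>I. w z (f i) *\<^sub>R e i + w (e i) z *\<^sub>R f i)" for z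
  have pV: "z - p z \<in> V" for z
  proof -
    have "w (z - p z) (e j) = 0 \<and> w (z - p z) (f j) = 0" if j: "j \<in> I" for j
    proof
      have "w (p z) (e j) = (\<Sum>i\<in>I. if i = j then - w (e j) z else 0)"
        unfolding p_def w.sum_left using j
        by (intro sum.cong) (auto simp: w.add_left w.scaleR_left ee ef alt[of "f _" "e j"])
      then show "w (z - p z) (e j) = 0"
        using insert j alt[of z "e j"] by (simp add: w.diff_left)
      have "w (p z) (f j) = (\<Sum>i\<in>I. if i = j then w z (f j) else 0)"
        unfolding p_def w.sum_left using j
        by (intro sum.cong) (auto simp: w.add_left w.scaleR_left ff ef)
      then show "w (z - p z) (f j) = 0"
        using insert j by (simp add: w.diff_left)
    qed
    then show ?thesis by (simp add: V_def)
  qed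
  have Ve: "w v (e i) = 0" "w v (f i) = 0" "w (e i) v = 0" "w (f i) v = 0"
    "q (e i) v = 0" "q (f i) v = 0" if "v \<in> V" "i \<in> I" for v i
    using that alt[of _ v] sym[of _ v] by (auto simp: V_def qe qf)
  have wp: "w v (p z) = 0" "w (p z) v = 0" "q (p z) v = 0" if "v \<in> V" for v z
    using that by (simp_all add: p_def w.sum_left w.sum_right q.sum_left w.add_left w.add_right
        q.add_left w.scaleR_left w.scaleR_right q.scaleR_left Ve)
  \<comment> \<open>If \<open>V\<close> were trivial, \<open>p\<close> would be the identity and at
    most \<open>2 * card I\<close> vectors would span the space, whose dimension is at least
    \<open>2 * card I + 2\<close>.\<close>
  have "\<exists>v\<in>V. v \<noteq> 0"
  proof (rule ccontr)
    assume "\<not> ?thesis"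
    then have "z = p z" for z using pV[of z] by force
    moreover have "p z \<in> span (e ` I \<union> f ` I)" for z
      unfolding p_def by (intro span_sum span_add span_scale span_base) auto
    ultimately have "UNIV \<subseteq> span (e ` I \<union> f ` I)" by (metis subsetI)
    then have "dim (UNIV :: 'a set) \<le> card (e ` I \<union> f ` I)"
      using insert by (intro dim_le_card) auto
    also have "\<dots> \<le> card (e ` I) + card (f ` I)" by (rule card_Un_le)
    also have "\<dots> \<le> 2 * card I" using card_image_le[OF insert(1)] by (metis add_mono mult_2)
    finally show False using insert by simp
  qed
  then obtain v y where v: "v \<in> V" "w v y \<noteq> 0" using nondeg by blast
  \<comment> \<open>Since \<open>w v (p y) = 0\<close>, the witness \<open>y\<close> can be moved
    into \<open>V\<close>; thus \<open>w\<close> does not vanish on \<open>V\<close>.\<close>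
  then have "w v (y - p y) \<noteq> 0" by (simp add: w.diff_right wp)
  then have "\<exists>x\<in>V. \<exists>y\<in>V. w x y \<noteq> 0" using v(1) pV by blast
  then obtain e' f' d' where V': "e' \<in> V" "f' \<in> V" and d': "d' > 0" and ef': "w e' f' = 1"
    and qe': "\<And>z. z \<in> V \<Longrightarrow> q z e' = d' * w z f'" and qf': "\<And>z. z \<in> V \<Longrightarrow> q z f' = d' * w e' z"
    using symplectic_pair_exists[OF q sym pos w V] by metis
  \<comment> \<open>The component \<open>p z\<close> pairs to zero with \<open>V\<close> under both
    forms, so the relation for \<open>z - p z\<close> is the relation for \<open>z\<close>.\<close>
  have qe'': "q z e' = d' * w z f'" for z
    using qe'[OF pV[of z]] V' by (simp add: q.diff_left w.diff_left wp)
  have qf'': "q z f' = d' * w e' z" for z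
    using qf'[OF pV[of z]] V' by (simp add: q.diff_left w.diff_right wp)
  show ?case
  proof (intro exI conjI)
    let ?e = "e(k := e')" and ?f = "f(k := f')" and ?d = "d(k := d')"
    show "\<forall>i\<in>insert k I. ?d i > 0 \<and> (\<forall>z. q z (?e i) = ?d i * w z (?f i)) \<and>
             (\<forall>z. q z (?f i) = ?d i * w (?e i) z)"
      using d d' qe qf qe'' qf'' insert(2) by auto
    show "\<forall>i\<in>insert k I. \<forall>j\<in>insert k I. w (?e i) (?f j) = (if i = j then 1 else 0) \<and>
             w (?e i) (?e j) = 0 \<and> w (?f i) (?f j) = 0"
      using insert(2) V' ef ee ff ef' by (auto simp: Ve ww)
  qed
qed

subsection \<open>Homeomorphisms between quotient spaces\<close>

text \<open>Continuity of \<open>F\<close> is the universal property of the quotient, and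
  \<open>rel\<close> and \<open>surj\<close> make it bijective. Closedness reduces to the hypothesis
  on saturated closed sets, since the preimage in \<open>Y\<close> of the image of a closed set of
  classes is the saturation of an image under \<open>f\<close>.\<close>

lemma homeomorphic_map_quotient:
  fixes f :: "'a \<Rightarrow> 'b"
  assumes r: "equiv (topspace X) r" and s: "equiv (topspace Y) s"
    and f: "continuous_map X Y f"
    and rel: "\<And>x x'. x \<in> topspace X \<Longrightarrow> x' \<in> topspace X \<Longrightarrow> (f x, f x') \<in> s \<longleftrightarrow> (x, x') \<in> r"
    and surj: "\<And>y. y \<in> topspace Y \<Longrightarrow> \<exists>x\<in>topspace X. (f x, y) \<in> s"
    and closed: "\<And>T. closedin X T \<Longrightarrow> r `` T \<subseteq> T \<Longrightarrow> closedin Y (s `` (f ` T))"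
    and F: "\<And>x. x \<in> topspace X \<Longrightarrow> F (r `` {x}) = s `` {f x}"
  shows "homeomorphic_map (quotient_topology X r) (quotient_topology Y s) F"
proof -
  let ?X = "quotient_topology X r" and ?Y = "quotient_topology Y s"
  have fY: "f x \<in> topspace Y" if "x \<in> topspace X" for x
    using continuous_map_image_subset_topspace[OF f] that by blast
  have "continuous_map X ?Y (\<lambda>x. s `` {f x})"
    using continuous_map_compose[OF f quotient_imp_continuous_map[OF quotient_map_proj]]
    by (simp add: comp_def)
  then have "continuous_map X ?Y (F \<circ> (\<lambda>x. r `` {x}))"
    by (rule continuous_map_eq) (simp add: F)
  then have cont: "continuous_map ?X ?Y F"
    by (rule continuous_compose_quotient_map[OF quotient_map_proj])
  have surjF: "F ` topspace ?X = topspace ?Y"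
  proof
    show "F ` topspace ?X \<subseteq> topspace ?Y"
      by (rule continuous_map_image_subset_topspace[OF cont])
    show "topspace ?Y \<subseteq> F ` topspace ?X"
    proof
      fix C assume "C \<in> topspace ?Y"
      then obtain y where y: "y \<in> topspace Y" "C = s `` {y}"
        by (auto simp: topspace_quotient_topology quotient_def)
      obtain x where x: "x \<in> topspace X" "(f x, y) \<in> s" using surj[OF y(1)] by blast
      then have "C = F (r `` {x})" using F equiv_class_eq[OF s x(2)] y by simp
      then show "C \<in> F ` topspace ?X"
        using x(1) by (auto simp: topspace_quotient_topology quotient_def)
    qed
  qed
  have inj: "inj_on F (topspace ?X)"
  proof (rule inj_onI)
    fix C C' assume "C \<in> topspace ?X" "C' \<in> topspace ?X" and eq: "F C = F C'"
    then obtain x x' where x: "x \<in> topspace X" "C = r `` {x}" "x' \<in> topspace X" "C' = r `` {x'}"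
      by (auto simp: topspace_quotient_topology quotient_def)
    then have "s `` {f x} = s `` {f x'}" using eq F by simp
    then have "(f x, f x') \<in> s" using s fY[OF x(3)] by (rule eq_equiv_class)
    then show "C = C'" using rel x equiv_class_eq[OF r] by blast
  qed
  have "closed_map ?X ?Y F"
    unfolding closed_map_def
  proof (intro allI impI)
    fix U assume U: "closedin ?X U"
    \<comment> \<open>The preimage of \<open>U\<close> under the projection: closed and saturated,
      as the hypothesis \<open>closed\<close> demands.\<close>
    define T where "T = {x \<in> topspace X. r `` {x} \<in> U}"
    have subU: "U \<subseteq> topspace X // r"
      using closedin_subset[OF U] by (simp add: topspace_quotient_topology)
    have T: "closedin X T" unfolding T_def
      using quotient_imp_continuous_map[OF quotient_map_proj] U by (rule closedin_continuous_map_preimage)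
    have "r `` T \<subseteq> T"
    proof
      fix y assume "y \<in> r `` T"
      then obtain x where x: "x \<in> T" "(x, y) \<in> r" by blast
      then have "r `` {y} = r `` {x}" "y \<in> topspace X"
        using equiv_class_eq[OF r] r by (auto simp: equiv_def)
      then show "y \<in> T" using x(1) by (simp add: T_def)
    qed
    then have clo: "closedin Y (s `` (f ` T))" by (rule closed[OF T])
    have pre: "{y \<in> topspace Y. s `` {y} \<in> F ` U} = s `` (f ` T)"
    proof (intro equalityI subsetI)
      fix y assume "y \<in> {y \<in> topspace Y. s `` {y} \<in> F ` U}"
      then obtain C where y: "y \<in> topspace Y" "C \<in> U" "s `` {y} = F C" by auto
      then obtain x where x: "x \<in> topspace X" "C = r `` {x}" using subU by (auto simp: quotient_def)
      then have "s `` {f x} = s `` {y}" using y F by simp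
      then have "(f x, y) \<in> s" using s y(1) by (rule eq_equiv_class)
      then show "y \<in> s `` (f ` T)" using x y(2) by (auto simp: T_def)
    next
      fix y assume "y \<in> s `` (f ` T)"
      then obtain x where x: "x \<in> T" "(f x, y) \<in> s" by auto
      then have "s `` {y} = F (r `` {x})" using F equiv_class_eq[OF s x(2)] by (simp add: T_def)
      moreover have "y \<in> topspace Y" using x(2) s by (auto simp: equiv_def)
      ultimately show "y \<in> {y \<in> topspace Y. s `` {y} \<in> F ` U}" using x(1) by (auto simp: T_def)
    qed
    have FU: "F ` U \<subseteq> topspace ?Y"
      using surjF closedin_subset[OF U] by blast
    have "\<forall>C \<subseteq> topspace ?Y. closedin Y {y \<in> topspace Y. s `` {y} \<in> C} = closedin ?Y C"
      by (rule conjunct2[OF quotient_map_proj[of Y s, unfolded quotient_map_closedin]])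
    from this[THEN spec[of _ "F ` U"], THEN mp, OF FU]
    show "closedin ?Y (F ` U)" by (simp only: pre clo)
  qed
  then show ?thesis
    using cont surjF inj by (simp add: bijective_closed_imp_homeomorphic_map)
qed

subsection \<open>Diagonal and symplectic matrices\<close>

lemma matrix_mult_minus:
  fixes A :: "real^'n^'m" and B :: "real^'p^'n"
  shows "A ** (- B) = - (A ** B)" "(- A) ** B = - (A ** B)"
  by (simp_all add: vec_eq_iff matrix_matrix_mult_def sum_negf)

lemma diag2_nth: "diag2 d $ a $ b = (if a = b then d $ (case a of Inl i \<Rightarrow> i | Inr i \<Rightarrow> i) else 0)"
  by (auto simp: diag2_def diag_def block_matrix_def split: sum.splits)

lemma diag2_mult_nth: "(diag2 d ** A) $ a $ b = d $ (case a of Inl i \<Rightarrow> i | Inr i \<Rightarrow> i) * A $ a $ b"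
  by (simp add: matrix_matrix_mult_def diag2_nth if_distrib if_distribR cong: if_cong)

lemma mult_diag2_nth: "(A ** diag2 d) $ a $ b = A $ a $ b * d $ (case b of Inl i \<Rightarrow> i | Inr i \<Rightarrow> i)"
  by (simp add: matrix_matrix_mult_def diag2_nth if_distrib if_distribR cong: if_cong)

lemma diag2_mult_vec_nth: "(diag2 d *v x) $ a = d $ (case a of Inl i \<Rightarrow> i | Inr i \<Rightarrow> i) * x $ a"
  by (simp add: matrix_vector_mult_def diag2_nth if_distrib if_distribR cong: if_cong)

lemma JJ_diag2: "JJ ** diag2 d = diag2 d ** JJ"
  by (auto simp: vec_eq_iff mult_diag2_nth diag2_mult_nth JJ_def block_matrix_def mat_def split: sum.splits)

lemma JJ_JJ: "JJ ** JJ = - (mat 1 :: ('n::finite) mat2)"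
proof -
  have "JJ ** JJ = block_matrix (- mat 1) 0 0 (- mat 1 :: real^'n^'n)"
    unfolding JJ_def block_matrix_mult by (simp add: matrix_mult_minus)
  then show ?thesis
    by (auto simp: vec_eq_iff block_matrix_def mat_def split: sum.splits)
qed

lemma sum_UNIV_sum_type:
  "(\<Sum>a\<in>UNIV. f a) = (\<Sum>i\<in>UNIV. f (Inl i)) + (\<Sum>i\<in>UNIV. f (Inr i))"
  for f :: "'a::finite + 'b::finite \<Rightarrow> 'c::comm_monoid_add"
  using sum.Plus[of "UNIV :: 'a set" "UNIV :: 'b set" f] by (simp add: comp_def)

lemma JJ_mult_vec: "(JJ *v x) $ Inl i = x $ Inr i" "(JJ *v x) $ Inr i = - x $ Inl i"
proof -
  have 1: "(\<Sum>j\<in>UNIV. mat 1 $ i $ j * x $ Inr j) = x $ Inr i"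
    by (simp add: mat_def if_distribR if_distrib[of "\<lambda>t. t * _"] cong: if_cong)
  have 2: "(\<Sum>j\<in>UNIV. - mat 1 $ i $ j * x $ Inl j) = - x $ Inl i"
    by (simp add: mat_def sum_negf if_distribR if_distrib[of "\<lambda>t. t * _"] cong: if_cong)
  show "(JJ *v x) $ Inl i = x $ Inr i" "(JJ *v x) $ Inr i = - x $ Inl i"
    using 1 2 by (simp_all add: JJ_def matrix_vector_mult_def block_matrix_def sum_UNIV_sum_type)
qed

lemma norm_JJ: "norm (JJ *v x) = norm x"
proof -
  have "(JJ *v x) \<bullet> (JJ *v x) = x \<bullet> x"
    by (simp add: inner_vec_def JJ_mult_vec sum_UNIV_sum_type)
  then show ?thesis by (simp add: norm_eq_sqrt_inner)
qed

lemma transpose_JJ: "transpose JJ = - (JJ :: ('n::finite) mat2)"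
  by (auto simp: JJ_def block_matrix_def mat_def transpose_def vec_eq_iff split: sum.splits)

lemma transpose_diag2: "transpose (diag2 d) = diag2 d"
  by (auto simp: vec_eq_iff transpose_def diag2_nth)

section \<open>Symplectic eigenvalues are determined up to permutation\<close>

text \<open>A nonzero determinant has a nonzero term in its expansion over permutations.\<close>

lemma invertible_imp_perm_nonzero:
  fixes L :: "real^'m^'m"
  assumes "invertible L"
  obtains p where "p permutes UNIV" "\<And>i. L $ i $ p i \<noteq> 0"
proof -
  have "det L \<noteq> 0" using assms by (simp add: invertible_det_nz)
  then obtain p where "p permutes (UNIV :: 'm set)" "of_int (sign p) * (\<Prod>i\<in>UNIV. L $ i $ p i) \<noteq> 0"
    unfolding det_def by (metis (mono_tags, lifting) mem_Collect_eq sum.neutral)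
  then show ?thesis using that by auto
qed

text \<open>Every index of \<open>'n\<close> is hit twice, once through \<open>Inl\<close> and once
  through \<open>Inr\<close>; this is how \<open>diag2\<close> repeats the entries of
  \<open>d\<close>.\<close>

lemma mset_case_sum:
  "image_mset (\<lambda>a. g (case a of Inl i \<Rightarrow> i | Inr i \<Rightarrow> i)) (mset_set (UNIV :: ('n::finite + 'n) set)) =
   image_mset g (mset_set UNIV) + image_mset g (mset_set UNIV)"
proof -
  have "mset_set (UNIV :: ('n + 'n) set) = mset_set (range Inl \<union> range Inr)"
    by (simp add: UNIV_sum)
  also have "\<dots> = mset_set (range Inl) + mset_set (range Inr)"
    by (rule mset_set_Union) auto
  also have "\<dots> = image_mset Inl (mset_set UNIV) + image_mset Inr (mset_set UNIV)"
    by (simp add: image_mset_mset_set)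
  finally show ?thesis by (simp add: image_mset.compositionality comp_def)
qed

text \<open>\<open>L\<close> intertwines the squares of \<open>JJ ** diag2 d1\<close> and
  \<open>JJ ** diag2 d2\<close>, which are minus the squared diagonals, so a nonzero entry of
  \<open>L\<close> forces the matching diagonal entries to agree. Nonzero entries along a
  permutation identify the doubled multisets of \<open>d1\<close> and \<open>d2\<close>.\<close>

lemma sys_iso_diag2_imp_perm:
  fixes d1 d2 :: "real^'n::finite"
  assumes pos: "\<And>i. d1 $ i > 0" "\<And>i. d2 $ i > 0"
    and L: "invertible L" and eq: "L ** JJ ** diag2 d1 = JJ ** diag2 d2 ** L"
  obtains \<sigma> where "\<sigma> permutes UNIV" "\<And>i. d1 $ i = d2 $ \<sigma> i"
proof -
  define \<pi> :: "'n + 'n \<Rightarrow> 'n" where "\<pi> = (\<lambda>a. case a of Inl i \<Rightarrow> i | Inr i \<Rightarrow> i)"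
  have sq: "(JJ ** diag2 d) ** (JJ ** diag2 d) = - (diag2 d ** diag2 d)" for d :: "real^'n"
  proof -
    have "(JJ ** diag2 d) ** (JJ ** diag2 d) = diag2 d ** (JJ ** JJ) ** diag2 d"
      by (metis JJ_diag2 matrix_mul_assoc)
    then show ?thesis by (simp add: JJ_JJ vec_eq_iff mult_diag2_nth diag2_mult_nth diag2_nth mat_def)
  qed
  have "L ** ((JJ ** diag2 d1) ** (JJ ** diag2 d1)) = (L ** JJ ** diag2 d1) ** (JJ ** diag2 d1)"
    by (simp add: matrix_mul_assoc)
  also have "\<dots> = (JJ ** diag2 d2) ** (L ** JJ ** diag2 d1)"
    by (subst eq) (simp only: matrix_mul_assoc)
  also have "\<dots> = ((JJ ** diag2 d2) ** (JJ ** diag2 d2)) ** L"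
    unfolding eq by (simp only: matrix_mul_assoc)
  finally have "L ** (- (diag2 d1 ** diag2 d1)) = (- (diag2 d2 ** diag2 d2)) ** L" by (simp add: sq)
  then have "L ** diag2 d1 ** diag2 d1 = diag2 d2 ** (diag2 d2 ** L)"
    by (simp add: matrix_mult_minus matrix_mul_assoc)
  then have ent: "L $ a $ b * (d1 $ \<pi> b * d1 $ \<pi> b) = L $ a $ b * (d2 $ \<pi> a * d2 $ \<pi> a)" for a b
    by (simp add: vec_eq_iff mult_diag2_nth diag2_mult_nth \<pi>_def mult_ac)
  obtain p where p: "p permutes UNIV" "\<And>a. L $ a $ p a \<noteq> 0"
    using invertible_imp_perm_nonzero[OF L] by blast
  \<comment> \<open>Cancelling the nonzero entry leaves equal squares of positive numbers.\<close>
  have "d2 $ \<pi> a = d1 $ \<pi> (p a)" for a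
    using ent[of a "p a"] p(2)[of a] pos[THEN less_imp_le]
    by (simp add: power2_eq_square[symmetric] power2_eq_iff_nonneg)
  then have "image_mset (\<lambda>a. d2 $ \<pi> a) (mset_set UNIV) =
      image_mset (\<lambda>a. d1 $ \<pi> a) (image_mset p (mset_set UNIV))"
    by (simp add: image_mset.compositionality comp_def)
  also have "image_mset p (mset_set UNIV) = mset_set UNIV"
    using p(1) by (simp add: image_mset_mset_set permutes_inj permutes_image permutes_surj)
  finally have "image_mset (($) d2) (mset_set UNIV) + image_mset (($) d2) (mset_set UNIV) =
      image_mset (($) d1) (mset_set UNIV) + image_mset (($) d1) (mset_set UNIV)"
    by (simp add: \<pi>_def mset_case_sum)
  from arg_cong[OF this, of count]
  \<comment> \<open>\<open>p\<close> may mix the two halves of the indices, so it does not itself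
    yield \<open>\<sigma>\<close>; halving the multiplicities of the doubled multisets does.\<close>
  have "image_mset (($) d1) (mset_set UNIV) = image_mset (($) d2) (mset_set UNIV)"
    by (intro multiset_eqI) (simp add: fun_eq_iff, metis mult_2 mult_cancel1 zero_neq_numeral)
  then obtain \<sigma> where "\<sigma> permutes UNIV" "\<forall>i\<in>UNIV. d1 $ i = d2 $ \<sigma> i"
    using image_mset_eq_implies_permutes[OF finite] by metis
  then show ?thesis using that by blast
qed

lemma perm2_conj_diag2:
  fixes d1 d2 :: "real^'n::finite"
  assumes \<sigma>: "\<sigma> permutes UNIV" and d: "\<And>i. d1 $ i = d2 $ \<sigma> i"
  shows "perm2 \<sigma> ** diag2 d1 ** transpose (perm2 \<sigma>) = diag2 d2"
proof -
  have "perm2 \<sigma> ** diag2 d1 = diag2 d2 ** perm2 \<sigma>"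
    by (auto simp: vec_eq_iff mult_diag2_nth diag2_mult_nth perm2_def block_matrix_def perm_matrix_def d
        split: sum.splits)
  then show ?thesis using perm2_inverses[OF \<sigma>] by (simp add: matrix_mul_assoc[symmetric])
qed

section \<open>Positive definiteness, and the two relations on diagonal systems\<close>

lemma sys_rel_iff:
  "((Q1, B1), (Q2, B2)) \<in> sys_rel \<longleftrightarrow>
    sym_pos_def Q1 \<and> sym_pos_def Q2 \<and> (\<exists>L. sys_iso L Q1 B1 Q2 B2)"
  by (auto simp: sys_rel_def PH_def sys_iso_def)

lemma sym_pos_def_diag2:
  fixes d :: "real^'n::finite"
  assumes "\<And>i. d $ i > 0"
  shows "sym_pos_def (diag2 d)"
proof -
  have "x \<bullet> (diag2 d *v x) > 0" if x: "x \<noteq> 0" for x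
  proof -
    define \<pi> :: "'n + 'n \<Rightarrow> 'n" where "\<pi> = (\<lambda>a. case a of Inl i \<Rightarrow> i | Inr i \<Rightarrow> i)"
    obtain a where a: "x $ a \<noteq> 0" using x by (auto simp: vec_eq_iff)
    have "x \<bullet> (diag2 d *v x) = (\<Sum>b\<in>UNIV. d $ \<pi> b * (x $ b)\<^sup>2)"
      by (simp add: inner_vec_def diag2_mult_vec_nth \<pi>_def power2_eq_square mult_ac)
    also have "\<dots> > 0"
      using a assms by (intro sum_pos2[of _ a]) (auto simp: less_imp_le)
    finally show ?thesis .
  qed
  then show ?thesis by (simp add: sym_pos_def_def transpose_diag2)
qed

lemma sym_pos_def_congruence:
  assumes Q: "sym_pos_def Q" and S: "invertible S"
  shows "sym_pos_def (transpose S ** Q ** S)"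
proof -
  have "x \<bullet> ((transpose S ** Q ** S) *v x) = (S *v x) \<bullet> (Q *v (S *v x))" for x
    by (simp add: matrix_vector_mul_assoc[symmetric] inner_commute[of x] dot_lmul_matrix inner_commute[of "S *v x"])
  moreover have "S *v x \<noteq> 0" if "x \<noteq> 0" for x
    using S that by (metis invertible_def matrix_left_invertible_ker)
  ultimately show ?thesis
    using Q by (simp add: sym_pos_def_def matrix_transpose_mul matrix_mul_assoc)
qed

text \<open>By \<open>star_rel_iff'\<close> the relations differ only in the permutation that
  conjugates the diagonals, and \<open>sys_iso_diag2_imp_perm\<close> extracts one from any
  isomorphism.\<close>

lemma star_rel_iff_sys_rel:
  fixes d1 d2 :: "real^'n::finite" and v1 v2 :: "'n vec2"
  assumes "(d1, v1) \<in> Theta" "(d2, v2) \<in> Theta"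
  shows "((diag2 d1, v1), (diag2 d2, v2)) \<in> sys_rel \<longleftrightarrow> ((d1, v1), (d2, v2)) \<in> star_rel"
proof -
  have pos: "\<And>i. d1 $ i > 0" "\<And>i. d2 $ i > 0" using assms by (auto simp: Theta_def)
  have "\<exists>\<sigma>. \<sigma> permutes UNIV \<and> perm2 \<sigma> ** diag2 d1 ** transpose (perm2 \<sigma>) = diag2 d2"
    if L: "sys_iso L (diag2 d1) v1 (diag2 d2) v2" for L
  proof -
    have "invertible L" "L ** JJ ** diag2 d1 = JJ ** diag2 d2 ** L"
      using L by (simp_all add: sys_iso_def)
    then obtain \<sigma> where "\<sigma> permutes UNIV" "\<And>i. d1 $ i = d2 $ \<sigma> i"
      using sys_iso_diag2_imp_perm[OF pos] by blast
    then show ?thesis using perm2_conj_diag2 by blast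
  qed
  then show ?thesis
    unfolding sys_rel_iff star_rel_iff'
    using assms sym_pos_def_diag2[OF pos(1)] sym_pos_def_diag2[OF pos(2)] by blast
qed

section \<open>Symplectic matrices as system isomorphisms\<close>

text \<open>Multiply the defining relation by \<open>JJ\<close> and use
  \<open>JJ ** JJ = - mat 1\<close>. The explicit inverse is visibly continuous in \<open>R\<close>,
  which the limit argument exploits.\<close>

lemma symplectic_inverse:
  assumes "R \<in> Sp"
  shows "R ** - (JJ ** transpose R ** JJ) = mat 1" "- (JJ ** transpose R ** JJ) ** R = mat 1"
proof -
  have "(JJ ** transpose R ** JJ) ** R = JJ ** (transpose R ** JJ ** R)"
    by (simp only: matrix_mul_assoc)
  also have "\<dots> = - mat 1" using assms by (simp add: Sp_def JJ_JJ)
  finally show *: "- (JJ ** transpose R ** JJ) ** R = mat 1" by (simp add: matrix_mult_minus)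
  show "R ** - (JJ ** transpose R ** JJ) = mat 1"
    using matrix_left_right_inverse1[OF *] .
qed

lemma symplectic_transpose:
  assumes "R \<in> Sp"
  shows "R ** JJ ** transpose R = JJ"
proof -
  have "R ** JJ ** transpose R = R ** - (JJ ** transpose R ** JJ) ** JJ"
    by (simp add: matrix_mult_minus matrix_mul_assoc[symmetric] JJ_JJ)
  then show ?thesis by (simp add: symplectic_inverse[OF assms])
qed

lemma matrix_inv_inverses:
  fixes A :: "real^'n^'n"
  assumes "invertible A"
  shows "A ** matrix_inv A = mat 1" "matrix_inv A ** A = mat 1"
  using assms someI_ex[of "\<lambda>B. A ** B = mat 1 \<and> B ** A = mat 1"]
  by (simp_all add: matrix_inv_def invertible_def)

lemma symplectic_invertible: "R \<in> Sp \<Longrightarrow> invertible R"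
  unfolding invertible_def using symplectic_inverse by blast

text \<open>Since \<open>R ** JJ ** transpose R = JJ\<close>, a symplectic congruence of the
  Hamiltonian is a change of coordinates of the system. This gives both independence of
  \<open>S\<close> and surjectivity.\<close>

lemma sys_iso_symplectic:
  assumes "R \<in> Sp"
  shows "sys_iso R (transpose R ** Q ** R) v Q (R *v v)"
proof -
  have "R ** JJ ** (transpose R ** Q ** R) = (R ** JJ ** transpose R) ** Q ** R"
    by (simp only: matrix_mul_assoc)
  then have "R ** JJ ** (transpose R ** Q ** R) = JJ ** Q ** R"
    by (simp only: symplectic_transpose[OF assms])
  moreover have "v v* (transpose R ** Q ** R) = (R *v v) v* (Q ** R)"
    by (simp only: vector_matrix_mul_assoc[symmetric] vector_transpose_matrix)
  ultimately show ?thesis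
    unfolding sys_iso_def using symplectic_invertible[OF assms] by blast
qed

section \<open>Bilinearity and limits of matrix operations\<close>

lemma matrix_vector_mult_minus:
  fixes A :: "real^'n^'m"
  shows "A *v (- x) = - (A *v x)" "(- A) *v x = - (A *v x)"
  by (simp_all add: vec_eq_iff matrix_vector_mult_def sum_negf)

lemma bounded_bilinear_matrix_vector_mult:
  "bounded_bilinear (\<lambda>(A :: real^'n^'m) x. A *v x)"
  unfolding bilinear_conv_bounded_bilinear[symmetric] bilinear_def
  by (auto intro!: linearI simp: vec_eq_iff matrix_vector_mult_def algebra_simps sum.distrib
      sum_distrib_left)

lemma bounded_bilinear_matrix_mult:
  "bounded_bilinear (\<lambda>(A :: real^'n^'m) (B :: real^'p^'n). A ** B)"
  unfolding bilinear_conv_bounded_bilinear[symmetric] bilinear_def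
  by (auto intro!: linearI simp: vec_eq_iff matrix_matrix_mult_def algebra_simps sum.distrib
      sum_distrib_left)

lemma tendsto_transpose:
  fixes A :: "'a \<Rightarrow> real^'n^'m"
  assumes "(A \<longlongrightarrow> A0) F"
  shows "((\<lambda>k. transpose (A k)) \<longlongrightarrow> transpose A0) F"
  unfolding transpose_def using assms by (intro vec_tendstoI) (simp add: tendsto_vec_nth)

lemma tendsto_diag2:
  assumes "(d \<longlongrightarrow> d0) F"
  shows "((\<lambda>k. diag2 (d k)) \<longlongrightarrow> diag2 d0) F"
  by (intro vec_tendstoI) (auto simp: diag2_nth intro: tendsto_vec_nth assms)

subsection \<open>Williamson's theorem\<close>

lemma congruence_nth:
  fixes M :: "real^'m^'m"
  shows "(transpose R ** M ** R) $ a $ b = column a R \<bullet> (M *v column b R)"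
  unfolding matrix_mul_assoc[symmetric]
  by (simp add: matrix_matrix_mult_def transpose_def inner_vec_def column_def matrix_vector_mult_def)

lemma bounded_bilinear_matrix_form: "bounded_bilinear (\<lambda>x y. x \<bullet> (M *v y))"
  for M :: "real^'m^'m"
  by (rule bounded_bilinear.comp[OF bounded_bilinear_inner bounded_linear_ident
        matrix_vector_mul_bounded_linear])

text \<open>The columns of \<open>R\<close> are a symplectic family for the forms of
  \<open>Q\<close> and \<open>JJ\<close>. The values of \<open>w\<close> on them say that
  \<open>R\<close> is symplectic, and the relations between \<open>q\<close> and \<open>w\<close>
  then make \<open>Q\<close> diagonal with the same entry for \<open>e i\<close> and
  \<open>f i\<close>.\<close>

lemma williamson:
  fixes Q :: "('n::finite) mat2"
  assumes "sym_pos_def Q"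
  obtains R d where "R \<in> Sp" "\<And>i. d $ i > 0" "transpose R ** Q ** R = diag2 d"
proof -
  define q w :: "'n vec2 \<Rightarrow> 'n vec2 \<Rightarrow> real"
    where "q x y = x \<bullet> (Q *v y)" and "w x y = x \<bullet> (JJ *v y)" for x y
  have bil: "bounded_bilinear q" "bounded_bilinear w"
    unfolding q_def w_def by (rule bounded_bilinear_matrix_form)+
  have tr: "x \<bullet> (M *v y) = y \<bullet> (transpose M *v x)" for M :: "'n mat2" and x y
    by (simp add: dot_lmul_matrix inner_commute[of y])
  have sym: "q x y = q y x" for x y
    unfolding q_def using assms tr[of x Q y] by (simp only: sym_pos_def_def)
  have pos: "x \<noteq> 0 \<Longrightarrow> q x x > 0" for x
    using assms by (simp add: q_def sym_pos_def_def)
  have alt: "w x y = - w y x" for x y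
    unfolding w_def tr[of x] by (simp only: transpose_JJ matrix_vector_mult_minus inner_minus_right)
  \<comment> \<open>At \<open>y = JJ *v x\<close> the form equals minus the squared length of
    \<open>x\<close>.\<close>
  have nondeg: "\<exists>y. w x y \<noteq> 0" if "x \<noteq> 0" for x
    using that by (intro exI[of _ "JJ *v x"])
      (simp add: w_def matrix_vector_mul_assoc JJ_JJ matrix_vector_mult_minus)
  have "2 * card (UNIV :: 'n set) \<le> DIM('n vec2)" by (simp add: card_UNIV_sum)
  from symplectic_family_exists[OF bil(1) sym pos bil(2) alt nondeg finite this]
  obtain e f d where
    "\<forall>i\<in>(UNIV :: 'n set). d i > 0 \<and> (\<forall>z. q z (e i) = d i * w z (f i)) \<and> (\<forall>z. q z (f i) = d i * w (e i) z)"
    "\<forall>i\<in>(UNIV :: 'n set). \<forall>j\<in>(UNIV :: 'n set). w (e i) (f j) = (if i = j then 1 else 0) \<and>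
      w (e i) (e j) = 0 \<and> w (f i) (f j) = 0"
    by blast
  then have
    1: "\<And>i. d i > 0" "\<And>i z. q z (e i) = d i * w z (f i)" "\<And>i z. q z (f i) = d i * w (e i) z"
    and 2: "\<And>i j. w (e i) (f j) = (if i = j then 1 else 0)"
      "\<And>i j. w (e i) (e j) = 0" "\<And>i j. w (f i) (f j) = 0"
    by auto
  define R :: "'n mat2" where "R = (\<chi> a b. case_sum e f b $ a)"
  have R: "column b R = case_sum e f b" for b by (simp add: R_def column_def vec_eq_iff)
  have "(transpose R ** JJ ** R) $ a $ b = JJ $ a $ b" for a b
    unfolding congruence_nth R w_def[symmetric]
    by (auto simp: 2 alt[of "f _" "e _"] JJ_def block_matrix_def mat_def split: sum.splits)
  then have "R \<in> Sp" by (simp add: Sp_def vec_eq_iff)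
  moreover have "(transpose R ** Q ** R) $ a $ b = diag2 (\<chi> i. d i) $ a $ b" for a b
    unfolding congruence_nth R q_def[symmetric]
    by (auto simp: 1 2 diag2_nth split: sum.splits)
  then have "transpose R ** Q ** R = diag2 (\<chi> i. d i)" by (simp add: vec_eq_iff)
  ultimately show ?thesis using that[of R "\<chi> i. d i"] 1(1) by simp
qed

text \<open>Up to sign and the isometry \<open>JJ\<close>, \<open>Q\<close> sends \<open>e i\<close>
  to \<open>d $ i\<close> times \<open>f i\<close> and conversely. Comparing lengths around this
  two-cycle traps \<open>d $ i\<close> between the lower and upper bounds of \<open>Q\<close>; a
  column of \<open>R\<close> is then bounded because its \<open>Q\<close>-value is an entry of
  \<open>diag2 d\<close>.\<close>

lemma williamson_bounds:
  fixes Q R :: "('n::finite) mat2"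
  assumes R: "R \<in> Sp" and d: "\<And>i. d $ i > 0" and RQR: "transpose R ** Q ** R = diag2 d"
    and c: "c > 0" "\<And>x. c * (norm x)\<^sup>2 \<le> x \<bullet> (Q *v x)" and M: "\<And>x. norm (Q *v x) \<le> M * norm x"
  shows "c \<le> d $ i" "d $ i \<le> M" "c * (norm (column a R))\<^sup>2 \<le> M"
proof -
  \<comment> \<open>The left factor is the inverse of \<open>transpose R\<close>.\<close>
  have QR: "Q ** R = - (JJ ** R ** JJ) ** diag2 d"
  proof -
    have "- (JJ ** R ** JJ) ** transpose R = mat 1"
      using symplectic_transpose[OF R] 
      by (simp add: matrix_mult_minus matrix_mul_assoc[symmetric] JJ_JJ)
    then have "Q ** R = (- (JJ ** R ** JJ) ** transpose R) ** Q ** R" by simp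
    also have "\<dots> = - (JJ ** R ** JJ) ** (transpose R ** Q ** R)" by (simp only: matrix_mul_assoc)
    finally show ?thesis by (simp only: RQR)
  qed
  define e f where "e i = column (Inl i) R" and "f i = column (Inr i) R" for i
  have ax: "R *v axis b 1 = column b R" for b by (simp add: matrix_vector_mult_basis)
  have cl: "c * norm x \<le> norm (Q *v x)" for x
  proof (cases "x = 0")
    case False
    have "c * (norm x)\<^sup>2 \<le> norm x * norm (Q *v x)" using c(2)[of x] norm_cauchy_schwarz order_trans by blast
    then show ?thesis using False by (simp add: power2_eq_square)
  qed simp
  have De: "JJ *v (diag2 d *v axis (Inl i) 1) = - d $ i *\<^sub>R axis (Inr i) 1"
    "JJ *v (diag2 d *v axis (Inr i) 1) = d $ i *\<^sub>R axis (Inl i) 1" for i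
  proof -
    have *: "x = y" if "\<And>j. x $ Inl j = y $ Inl j" "\<And>j. x $ Inr j = y $ Inr j" for x y :: "'n vec2"
      using that unfolding vec_eq_iff by (metis sum.exhaust)
    show "JJ *v (diag2 d *v axis (Inl i) 1) = - d $ i *\<^sub>R axis (Inr i) 1"
      "JJ *v (diag2 d *v axis (Inr i) 1) = d $ i *\<^sub>R axis (Inl i) 1"
      by (rule *; simp add: JJ_mult_vec diag2_mult_vec_nth axis_def)+
  qed
  have QR': "Q *v column b R = - (JJ *v (R *v (JJ *v (diag2 d *v axis b 1))))" for b
  proof -
    have "Q *v column b R = (Q ** R) *v axis b 1"
      by (simp only: ax[symmetric] matrix_vector_mul_assoc)
    also have "\<dots> = - (JJ *v (R *v (JJ *v (diag2 d *v axis b 1))))"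
      unfolding QR matrix_mult_minus(2) matrix_vector_mult_minus(2)
      by (simp only: matrix_vector_mul_assoc matrix_mul_assoc)
    finally show ?thesis .
  qed
  have Qe: "norm (Q *v e i) = d $ i * norm (f i)" "norm (Q *v f i) = d $ i * norm (e i)" for i
    using d[of i] unfolding e_def f_def QR' De norm_minus_cancel norm_JJ
    by (simp_all only: matrix_vector_mult_scaleR ax norm_scaleR abs_minus_cancel abs_of_pos)
  have ne: "column b R \<noteq> 0" for b
  proof
    assume "column b R = 0"
    then have "R *v axis b 1 = 0" by (simp only: ax)
    then have "axis b (1 :: real) = (0 :: 'n vec2)"
      using symplectic_inverse(2)[OF R] matrix_left_invertible_ker[of R] by blast
    then show False by (simp add: axis_eq_0_iff)
  qed
  have *: "c \<le> d $ i \<and> d $ i \<le> M" for i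
  proof -
    have pos: "norm (e i) > 0" "norm (f i) > 0" using ne by (auto simp: e_def f_def)
    have "c * norm (e i) \<le> d $ i * norm (f i)" "d $ i * norm (f i) \<le> M * norm (e i)"
      "c * norm (f i) \<le> d $ i * norm (e i)" "d $ i * norm (e i) \<le> M * norm (f i)"
      using cl[of "e i"] cl[of "f i"] M[of "e i"] M[of "f i"] by (simp_all add: Qe)
    \<comment> \<open>Violating either bound makes each of \<open>e i\<close> and \<open>f i\<close>
      strictly longer than the other.\<close>
    moreover have False if "d $ i > M"
    proof -
      have "d $ i * norm (f i) < d $ i * norm (e i)" "d $ i * norm (e i) < d $ i * norm (f i)"
        using mult_strict_right_mono[OF that pos(1)] mult_strict_right_mono[OF that pos(2)]
          calculation by linarith+
      then show False by linarith
    qed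
    moreover have False if "c > d $ i"
    proof -
      have "c * norm (e i) < c * norm (f i)" "c * norm (f i) < c * norm (e i)"
        using mult_strict_right_mono[OF that pos(1)] mult_strict_right_mono[OF that pos(2)]
          calculation by linarith+
      then show False by linarith
    qed
    ultimately show ?thesis by force
  qed
  then show "c \<le> d $ i" "d $ i \<le> M" by auto
  have "c * (norm (column a R))\<^sup>2 \<le> diag2 d $ a $ a"
    using c(2)[of "column a R"] by (simp add: congruence_nth RQR[symmetric])
  also have "\<dots> \<le> M" using * by (simp add: diag2_nth)
  finally show "c * (norm (column a R))\<^sup>2 \<le> M" .
qed

text \<open>Near \<open>Q0\<close> the coercivity and norm bounds are uniform, so
  \<open>williamson_bounds\<close> confines \<open>R k\<close> and \<open>d k\<close> to a bounded
  set. A convergent subsequence exists, and the defining equations pass to its limit.\<close>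

lemma williamson_closed:
  fixes Q :: "nat \<Rightarrow> ('n::finite) mat2"
  assumes Q: "Q \<longlonglongrightarrow> Q0" "sym_pos_def Q0"
    and R: "\<And>k. R k \<in> Sp" and d: "\<And>k i. d k $ i > 0"
    and RQR: "\<And>k. transpose (R k) ** Q k ** R k = diag2 (d k)"
  obtains r R0 d0 where "strict_mono r" "(\<lambda>k. R (r k)) \<longlonglongrightarrow> R0" "(\<lambda>k. d (r k)) \<longlonglongrightarrow> d0"
    "R0 \<in> Sp" "\<And>i. d0 $ i > 0" "transpose R0 ** Q0 ** R0 = diag2 d0"
proof -
  interpret mv: bounded_bilinear "\<lambda>(A :: 'n mat2) x. A *v x"
    by (rule bounded_bilinear_matrix_vector_mult)
  note tendsto = bounded_bilinear.tendsto[OF bounded_bilinear_matrix_mult] tendsto_transpose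
  obtain c where c: "c > 0" "\<And>x. c * (norm x)\<^sup>2 \<le> x \<bullet> (Q0 *v x)"
    using pos_def_coercive[OF bounded_bilinear_matrix_form] Q(2) unfolding sym_pos_def_def by metis
  obtain K where K: "K > 0" "\<And>(A :: 'n mat2) x. norm (A *v x) \<le> norm A * norm x * K"
    using mv.pos_bounded by blast
  \<comment> \<open>Chosen so that a perturbation of norm below \<open>\<epsilon>\<close> costs at
    most half of the coercivity constant \<open>c\<close>.\<close>
  define \<epsilon> where "\<epsilon> = c / (2 * K)"
  have \<epsilon>: "\<epsilon> > 0" "\<epsilon> * K = c / 2" using c K by (auto simp: \<epsilon>_def)
  obtain N where N: "\<And>k. k \<ge> N \<Longrightarrow> norm (Q k - Q0) < \<epsilon>"
    using LIMSEQ_D[OF Q(1) \<epsilon>(1)] by blast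
  define M where "M = (norm Q0 + \<epsilon>) * K"
  have diff: "norm ((Q k - Q0) *v x) \<le> c / 2 * norm x" if "k \<ge> N" for k x
  proof -
    have "norm ((Q k - Q0) *v x) \<le> norm (Q k - Q0) * norm x * K" by (rule K(2))
    also have "\<dots> \<le> \<epsilon> * norm x * K"
      using N[OF that] K(1) by (intro mult_right_mono) auto
    also have "\<dots> = c / 2 * norm x" using \<epsilon>(2) by (simp add: mult.commute mult.left_commute)
    finally show ?thesis .
  qed
  have lower: "c / 2 * (norm x)\<^sup>2 \<le> x \<bullet> (Q k *v x)" if "k \<ge> N" for k x
  proof -
    have "- (x \<bullet> ((Q k - Q0) *v x)) \<le> norm x * norm ((Q k - Q0) *v x)"
      using Cauchy_Schwarz_ineq2[of x "(Q k - Q0) *v x"] by linarith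
    also have "\<dots> \<le> norm x * (c / 2 * norm x)" by (intro mult_left_mono diff that) auto
    finally show ?thesis
      using c(2)[of x] by (simp add: mv.diff_left inner_diff_right power2_eq_square algebra_simps)
  qed
  have upper: "norm (Q k *v x) \<le> M * norm x" if "k \<ge> N" for k x
  proof -
    have "norm (Q k) \<le> norm Q0 + \<epsilon>"
      using N[OF that] norm_triangle_sub[of "Q k" Q0] by linarith
    then have "norm (Q k) * norm x * K \<le> (norm Q0 + \<epsilon>) * norm x * K"
      using K(1) by (intro mult_right_mono) auto
    then show ?thesis
      using K(2)[of "Q k" x] by (simp add: M_def mult.commute mult.left_commute)
  qed
  have bounds: "c / 2 \<le> d k $ i" "d k $ i \<le> M" "c / 2 * (norm (column a (R k)))\<^sup>2 \<le> M"
    if "k \<ge> N" for k i a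
    by (rule williamson_bounds[OF R d RQR _ lower upper]; use that c in simp)+
  \<comment> \<open>The bound on column lengths that results from
    \<open>c / 2 * (norm (column a (R k)))\<^sup>2 \<le> M\<close>.\<close>
  define b where "b = sqrt (2 * M / c)"
  have norm_d: "norm (d k) \<le> real CARD('n) * M" if "k \<ge> N" for k
  proof -
    have "norm (d k) \<le> (\<Sum>i\<in>UNIV. \<bar>d k $ i\<bar>)" by (rule norm_le_l1_cart)
    also have "\<dots> \<le> (\<Sum>i\<in>(UNIV :: 'n set). M)"
      using d[of k] bounds(2)[OF that] by (intro sum_mono) (simp add: abs_of_pos)
    finally show ?thesis by simp
  qed
  have norm_R: "norm (R k) \<le> (\<Sum>a\<in>(UNIV :: ('n + 'n) set). \<Sum>a'\<in>(UNIV :: ('n + 'n) set). b)"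
    if "k \<ge> N" for k
  proof -
    have "\<bar>R k $ a $ a'\<bar> \<le> b" for a a'
    proof -
      have "\<bar>R k $ a $ a'\<bar> \<le> norm (column a' (R k))"
        using component_le_norm_cart[of "column a' (R k)" a] by (simp add: column_def)
      also have "\<dots> \<le> b"
        unfolding b_def using bounds(3)[OF that, of a'] c(1)
        by (intro real_le_rsqrt) (simp add: field_simps)
      finally show ?thesis .
    qed
    then have "norm (R k $ a) \<le> (\<Sum>a'\<in>(UNIV :: ('n + 'n) set). b)" for a
      by (intro order_trans[OF norm_le_l1_cart] sum_mono)
    then show ?thesis
      unfolding norm_vec_def[of "R k"] by (intro order_trans[OF L2_set_le_sum] sum_mono) auto
  qed
  \<comment> \<open>The shift discards the first \<open>N\<close> indices, where the bounds are not
    established.\<close>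
  have "bounded (range (\<lambda>k. (R (k + N), d (k + N))))"
    unfolding bounded_iff
    by (intro exI ballI, elim rangeE, simp only:)
      (rule order_trans[OF norm_Pair_le add_mono[OF norm_R norm_d]]; simp)
  then obtain l s where s: "strict_mono s"
    and l: "((\<lambda>k. (R (k + N), d (k + N))) \<circ> s) \<longlonglongrightarrow> l"
    using bounded_imp_convergent_subsequence by blast
  define r where "r k = s k + N" for k
  have r: "strict_mono r" using s by (simp add: r_def strict_mono_def)
  have lR: "(\<lambda>k. R (r k)) \<longlonglongrightarrow> fst l" and ld: "(\<lambda>k. d (r k)) \<longlonglongrightarrow> snd l"
    using tendsto_fst[OF l] tendsto_snd[OF l] by (simp_all add: r_def comp_def)
  have lQ: "(\<lambda>k. Q (r k)) \<longlonglongrightarrow> Q0"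
    using LIMSEQ_subseq_LIMSEQ[OF Q(1) r] by (simp add: comp_def)
  have "(\<lambda>k. transpose (R (r k)) ** JJ ** R (r k)) \<longlonglongrightarrow> transpose (fst l) ** JJ ** fst l"
    by (intro tendsto lR tendsto_const)
  moreover have "transpose (R (r k)) ** JJ ** R (r k) = JJ" for k
    using R by (simp add: Sp_def)
  ultimately have "fst l \<in> Sp"
    by (simp add: Sp_def LIMSEQ_const_iff)
  \<comment> \<open>Strict positivity survives the limit only through the uniform lower bound
    \<open>c / 2\<close>.\<close>
  moreover have "snd l $ i > 0" for i
  proof -
    have "c / 2 \<le> snd l $ i"
      using bounds(1) by (intro LIMSEQ_le_const[OF tendsto_vec_nth[OF ld]]) (auto simp: r_def)
    then show ?thesis using c(1) by simp
  qed
  moreover have "transpose (fst l) ** Q0 ** fst l = diag2 (snd l)"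
  proof (rule LIMSEQ_unique)
    show "(\<lambda>k. diag2 (d (r k))) \<longlonglongrightarrow> transpose (fst l) ** Q0 ** fst l"
      unfolding RQR[symmetric] by (intro tendsto lR lQ)
    show "(\<lambda>k. diag2 (d (r k))) \<longlonglongrightarrow> diag2 (snd l)" by (rule tendsto_diag2[OF ld])
  qed
  ultimately show ?thesis using that[OF r lR ld] by blast
qed

subsection \<open>The homeomorphism\<close>

text \<open>The matrix applied to \<open>B\<close> is the inverse of \<open>R\<close>, so
  \<open>R\<close> itself is the isomorphism. Written this way, the diagonal representative of
  \<open>(Q, B)\<close> varies continuously with \<open>R\<close> and \<open>B\<close>.\<close>

lemma sys_rel_diag2_symplectic:
  assumes R: "R \<in> Sp" and d: "\<And>i. d $ i > 0" and Q: "sym_pos_def Q"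
    and RQR: "transpose R ** Q ** R = diag2 d"
  shows "((diag2 d, - (JJ ** transpose R ** JJ) *v B), (Q, B)) \<in> sys_rel"
proof -
  have "R *v (- (JJ ** transpose R ** JJ) *v B) = B"
    by (simp only: matrix_vector_mul_assoc symplectic_inverse[OF R] matrix_vector_mul_lid)
  then have "sys_iso R (diag2 d) (- (JJ ** transpose R ** JJ) *v B) Q B"
    using sys_iso_symplectic[OF R, of Q "- (JJ ** transpose R ** JJ) *v B"] by (simp only: RQR)
  then show ?thesis using Q sym_pos_def_diag2[OF d] by (auto simp: sys_rel_iff)
qed

text \<open>\<open>S\<close> itself is the isomorphism, so the class of the image does not depend on
  \<open>S\<close>.\<close>

lemma param_map_sys_rel:
  assumes S: "S \<in> Sp" and x: "(d, v) \<in> Theta"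
  shows "(param_map S (d, v), (diag2 d, v)) \<in> sys_rel"
proof -
  have D: "sym_pos_def (diag2 d)" using x by (intro sym_pos_def_diag2) (simp add: Theta_def)
  have "S *v (matrix_inv S *v v) = v"
    by (simp only: matrix_vector_mul_assoc matrix_inv_inverses[OF symplectic_invertible[OF S]]
        matrix_vector_mul_lid)
  then have "sys_iso S (transpose S ** diag2 d ** S) (matrix_inv S *v v) (diag2 d) v"
    using sys_iso_symplectic[OF S, of "diag2 d" "matrix_inv S *v v"] by (simp only:)
  then show ?thesis
    using D sym_pos_def_congruence[OF D symplectic_invertible[OF S]]
    by (auto simp: sys_rel_iff param_map_def)
qed

text \<open>Take systems in the saturation converging to \<open>(Q0, B0)\<close>. Their given
  representatives in \<open>T\<close> are traded for Williamson representatives, which stay in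
  \<open>T\<close> by saturation and converge along a subsequence to a representative of the
  limit.\<close>

lemma closedin_saturation_diag2:
  fixes T :: "((real^'n::finite) \<times> 'n vec2) set"
  assumes T: "closedin (top_of_set Theta) T" and sat: "star_rel `` T \<subseteq> T"
  shows "closedin (top_of_set PH) (sys_rel `` ((\<lambda>(d, v). (diag2 d, v)) ` T))" (is "closedin _ ?W")
  unfolding closedin_limpt
proof (intro conjI allI impI)
  let ?f = "\<lambda>(d :: real^'n, v :: 'n vec2). (diag2 d, v)"
  show "?W \<subseteq> PH" using equiv_sys_rel by (auto simp: equiv_def)
  fix x assume x: "x islimpt ?W \<and> x \<in> PH"
  obtain Q0 B0 where x0: "x = (Q0, B0)" by fastforce
  then have Q0: "sym_pos_def Q0" using x by (simp add: PH_def)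
  obtain y where y: "\<And>k. y k \<in> ?W" "y \<longlonglongrightarrow> (Q0, B0)"
    using x unfolding x0 islimpt_sequential by blast
  define Q B where "Q k = fst (y k)" and "B k = snd (y k)" for k
  have lim: "Q \<longlonglongrightarrow> Q0" "B \<longlonglongrightarrow> B0"
    using tendsto_fst[OF y(2)] tendsto_snd[OF y(2)] by (simp_all add: Q_def[abs_def] B_def[abs_def])
  have "\<forall>k. \<exists>t\<in>T. (?f t, (Q k, B k)) \<in> sys_rel"
  proof
    fix k
    have "(Q k, B k) \<in> ?W" using y(1)[of k] by (simp add: Q_def B_def)
    then show "\<exists>t\<in>T. (?f t, (Q k, B k)) \<in> sys_rel" by blast
  qed
  then obtain t where t: "\<And>k. t k \<in> T" "\<And>k. (?f (t k), (Q k, B k)) \<in> sys_rel" by metis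
  have "sym_pos_def (Q k)" for k
    using t(2)[of k] by (auto simp: sys_rel_iff split: prod.splits)
  then have "\<forall>k. \<exists>R d. R \<in> Sp \<and> (\<forall>i. d $ i > 0) \<and> transpose R ** Q k ** R = diag2 d"
    using williamson by metis
  then obtain R d where R: "\<And>k. R k \<in> Sp" and d: "\<And>k i. d k $ i > 0"
    and RQR: "\<And>k. transpose (R k) ** Q k ** R k = diag2 (d k)"
    by metis
  define v where "v k = - (JJ ** transpose (R k) ** JJ) *v B k" for k
  \<comment> \<open>Both \<open>t k\<close> and \<open>(d k, v k)\<close> represent the system
    \<open>(Q k, B k)\<close>, so they are equivalent under \<open>star_rel\<close> and
    \<open>sat\<close> applies.\<close>
  have dvT: "(d k, v k) \<in> T" for k
  proof -
    have "(?f (d k, v k), (Q k, B k)) \<in> sys_rel"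
      using sys_rel_diag2_symplectic[OF R d \<open>sym_pos_def (Q k)\<close> RQR] by (simp add: v_def)
    with t(2) have rel: "(?f (t k), ?f (d k, v k)) \<in> sys_rel"
      by (meson equiv_sys_rel equivE symE transE)
    have "t k \<in> Theta" using t(1) closedin_subset[OF T] by auto
    moreover have "(d k, v k) \<in> Theta" using d by (simp add: Theta_def)
    ultimately have "(t k, (d k, v k)) \<in> star_rel"
      using star_rel_iff_sys_rel[of "fst (t k)" "snd (t k)" "d k" "v k"] rel
      by (simp add: case_prod_beta)
    then show ?thesis using t(1) sat by blast
  qed
  obtain r R0 d0 where r: "strict_mono r" and lR: "(\<lambda>k. R (r k)) \<longlonglongrightarrow> R0"
    and ld: "(\<lambda>k. d (r k)) \<longlonglongrightarrow> d0" and R0: "R0 \<in> Sp" and d0: "\<And>i. d0 $ i > 0"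
    and RQR0: "transpose R0 ** Q0 ** R0 = diag2 d0"
    using williamson_closed[OF lim(1) Q0 R d RQR] by metis
  define v0 where "v0 = - (JJ ** transpose R0 ** JJ) *v B0"
  have lB: "(\<lambda>k. B (r k)) \<longlonglongrightarrow> B0"
    using LIMSEQ_subseq_LIMSEQ[OF lim(2) r] by (simp add: comp_def)
  have "(\<lambda>k. v (r k)) \<longlonglongrightarrow> v0"
    unfolding v_def v0_def
    by (intro bounded_bilinear.tendsto[OF bounded_bilinear_matrix_vector_mult] tendsto_minus
        bounded_bilinear.tendsto[OF bounded_bilinear_matrix_mult] tendsto_transpose tendsto_const lR lB)
  then have lim0: "(\<lambda>k. (d (r k), v (r k))) \<longlonglongrightarrow> (d0, v0)"
    using ld by (rule tendsto_Pair[rotated])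
  \<comment> \<open>\<open>T\<close> is closed only relative to \<open>Theta\<close>; the limit lies
    in \<open>Theta\<close> because \<open>d0\<close> is positive.\<close>
  obtain C where C: "closed C" "T = Theta \<inter> C" using T by (auto simp: closedin_closed)
  then have "(d0, v0) \<in> C"
    using dvT by (intro closed_sequentially[OF C(1) _ lim0]) auto
  then have "(d0, v0) \<in> T" using d0 C(2) by (simp add: Theta_def)
  moreover have "(?f (d0, v0), x) \<in> sys_rel"
    using sys_rel_diag2_symplectic[OF R0 d0 Q0 RQR0] by (simp add: v0_def x0)
  ultimately show "x \<in> ?W" by blast
qed

theorem theorem4p9:
  shows "\<exists>\<Phi> :: ((real^'n::finite) \<times> 'n vec2) set \<Rightarrow>
              ('n mat2 \<times> 'n vec2) set.
    (\<forall>S\<in>Sp. induces_on_quotients (param_map S) Theta star_rel PH sys_rel \<Phi>) \<and>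
    (\<forall>(d, v)\<in>Theta. \<Phi> (star_rel `` {(d, v)}) = sys_rel `` {(diag2 d, v)}) \<and>
    homeomorphic_map
      (quotient_topology (top_of_set Theta) star_rel)
      (quotient_topology (top_of_set PH) sys_rel)
      \<Phi>"
proof -
  define f :: "(real^'n) \<times> 'n vec2 \<Rightarrow> 'n mat2 \<times> 'n vec2" where "f = (\<lambda>(d, v). (diag2 d, v))"
  \<comment> \<open>Saturating the image of the whole class avoids choosing a representative; on a
    \<open>star_rel\<close> class the result is a single \<open>sys_rel\<close> class.\<close>
  define \<Phi> where "\<Phi> C = sys_rel `` (f ` C)" for C
  have s: "equiv (PH :: ('n mat2 \<times> 'n vec2) set) sys_rel" by (rule equiv_sys_rel)
  have r: "equiv (Theta :: ((real^'n) \<times> 'n vec2) set) star_rel" by (rule equiv_star_rel)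
  have fPH: "f x \<in> PH" if "x \<in> Theta" for x
    using that by (auto simp: f_def Theta_def PH_def intro: sym_pos_def_diag2)
  have rel: "(f x, f x') \<in> sys_rel \<longleftrightarrow> (x, x') \<in> star_rel" if "x \<in> Theta" "x' \<in> Theta" for x x'
    using that star_rel_iff_sys_rel[of "fst x" "snd x" "fst x'" "snd x'"]
    by (simp add: f_def case_prod_beta)
  have sub: "star_rel \<subseteq> Theta \<times> (Theta :: ((real^'n) \<times> 'n vec2) set)"
    using r by (simp add: equiv_def)
  have \<Phi>: "\<Phi> (star_rel `` {x}) = sys_rel `` {f x}" if x: "x \<in> Theta" for x
  proof
    show "\<Phi> (star_rel `` {x}) \<subseteq> sys_rel `` {f x}"
    proof
      fix y assume "y \<in> \<Phi> (star_rel `` {x})"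
      then obtain x' where x': "(x, x') \<in> star_rel" "(f x', y) \<in> sys_rel" by (auto simp: \<Phi>_def)
      then have "(f x, f x') \<in> sys_rel" using rel sub by blast
      then show "y \<in> sys_rel `` {f x}" using x'(2) s by (auto elim: equivE dest: transD)
    qed
    have "(x, x) \<in> star_rel" using r x by (auto elim: equivE dest: refl_onD)
    then show "sys_rel `` {f x} \<subseteq> \<Phi> (star_rel `` {x})" by (auto simp: \<Phi>_def)
  qed
  have par: "(param_map S x, f x) \<in> sys_rel" if "S \<in> Sp" "x \<in> Theta" for S x
    using param_map_sys_rel[OF that(1), of "fst x" "snd x"] that(2) by (simp add: f_def case_prod_beta)
  have "induces_on_quotients (param_map S) Theta star_rel PH sys_rel \<Phi>" if S: "S \<in> Sp" for S
    unfolding induces_on_quotients_def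
  proof (intro conjI allI impI ballI)
    have "sys_rel \<subseteq> PH \<times> (PH :: ('n mat2 \<times> 'n vec2) set)" using s by (simp add: equiv_def)
    then show "param_map S ` Theta \<subseteq> PH" using par[OF S] by blast
    show "(param_map S x, param_map S y) \<in> sys_rel" if xy: "(x, y) \<in> star_rel" for x y
    proof -
      have "x \<in> Theta" "y \<in> Theta" using xy sub by auto
      then show ?thesis
        using par[OF S] rel xy s by (meson equivE symE transE)
    qed
    show "\<Phi> (star_rel `` {x}) = sys_rel `` {param_map S x}" if "x \<in> Theta" for x
      using \<Phi>[OF that] equiv_class_eq[OF s par[OF S that]] by simp
  qed
  moreover have "\<forall>(d, v)\<in>Theta. \<Phi> (star_rel `` {(d, v)}) = sys_rel `` {(diag2 d, v)}"
    using \<Phi> by (auto simp: f_def)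
  moreover have "homeomorphic_map (quotient_topology (top_of_set Theta) star_rel)
      (quotient_topology (top_of_set PH) sys_rel) \<Phi>"
  proof (rule homeomorphic_map_quotient[where f = f])
    show "equiv (topspace (top_of_set (Theta :: ((real^'n) \<times> 'n vec2) set))) star_rel"
      "equiv (topspace (top_of_set (PH :: ('n mat2 \<times> 'n vec2) set))) sys_rel"
      using r s by simp_all
    have "continuous_on UNIV f"
    proof -
      have "continuous_on UNIV (\<lambda>x :: (real^'n) \<times> 'n vec2. (diag2 (fst x), snd x))"
        unfolding continuous_on_def
        by (intro ballI tendsto_Pair tendsto_diag2 tendsto_fst tendsto_snd tendsto_ident_at)
      then show ?thesis by (simp add: f_def case_prod_beta')
    qed
    then show "continuous_map (top_of_set Theta) (top_of_set PH) f"
      using fPH by (auto intro: continuous_on_subset)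
    fix y assume "y \<in> topspace (top_of_set (PH :: ('n mat2 \<times> 'n vec2) set))"
    then obtain Q B where y: "y = (Q, B)" "sym_pos_def Q" by (auto simp: PH_def)
    obtain R d where "R \<in> Sp" "\<And>i. d $ i > 0" "transpose R ** Q ** R = diag2 d"
      using williamson[OF y(2)] by metis
    then show "\<exists>x\<in>topspace (top_of_set Theta). (f x, y) \<in> sys_rel"
      using sys_rel_diag2_symplectic[of R d Q B] y
      by (intro bexI[of _ "(d, - (JJ ** transpose R ** JJ) *v B)"]) (simp_all add: f_def Theta_def)
  qed (use rel closedin_saturation_diag2 \<Phi> in \<open>auto simp: f_def\<close>)
  ultimately show ?thesis by blast
qed

end
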